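(* Let $X^N=(X_0^N,\dots,X_d^N)$ be the Markov process described in the context and $\rho=\lambda/\mu$. Suppose that for some integer $2\leq p<d$ one has $p\beta<\rho<(p+1)\beta$, and that the initial state $X^N(0)$ is such that $X_i^N(0)=0$ for $1\leq i\leq d$, $i\notin\{p,p+1\}$, and $$\lim_{N\to+\infty}\left(\frac{X_p^N(0)}{N},\frac{X_{p+1}^N(0)}{N}\right)=\left((p+1)\beta-\rho,\ \rho-p\beta\right).$$ Then for any $q\leq p-2$, for the convergence in distribution of processes (in the variable $t\ge 0$), $$\lim_{N\to+\infty}\left(\frac{X_p^N(N^qt)}{N},\frac{X_{p+1}^N(N^qt)}{N}\right)=\left((p+1)\beta-\rho,\ \rho-p\beta\right).$$
   Context: Model. Fix real numbers $\lambda,\mu>0$ and an integer $d\ge 2$. For each integer $N\ge1$ let $F_N\in\mathbb{N}$, and assume there are $\beta>0$ and $\gamma\ge 0$ with $\lim_{N\to\infty}(F_N-N\beta)/\sqrt N=\gamma$. The process $X^N(t)=(X^N_0(t),\dots,X^N_d(t))$ is the continuous-time Markov jump process on $\{x=(x_0,\dots,x_d)\in\mathbb{N}^{d+1}:\sum_i x_i=F_N\}$ with the following transitions ($e_0,\dots,e_d$ are the unit vectors): (loss) for $1\le k\le d$, $x\to x-e_k+e_{k-1}$ at rate $\mu k x_k$; (duplication) for $1\le k\le d-1$, $x\to x-e_k+e_{k+1}$ at rate $\lambda N$ if $x_k>0$ and $x_i=0$ for all $1\le i<k$, and at rate $0$ otherwise. Convergence in distribution of processes (to a continuous limit) is understood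 on the space of càdlàg functions with the topology of uniform convergence on compact sets; the limit here is the constant process. *)

theory Defs
  imports "HOL-Probability.Probability"
begin

section \<open>Finite-state Markov jump processes\<close>

definition cadlag :: "(real \<Rightarrow> 'a::topological_space) \<Rightarrow> bool" where
  "cadlag f \<longleftrightarrow>
     (\<forall>t\<ge>0. (f \<longlongrightarrow> f t) (at_right t)) \<and> (\<forall>t>0. \<exists>l. (f \<longlongrightarrow> l) (at_left t))"

text \<open>
  For a finite set \<open>S\<close> and off-diagonal rates \<open>r\<close>, the function \<open>transition_prob S r t\<close>
  is the matrix exponential of \<open>t\<close> times the generator. The diagonal values of \<open>r\<close> are ignored.
\<close>

definition generator :: "'s set \<Rightarrow> ('s \<Rightarrow> 's \<Rightarrow> real) \<Rightarrow> 's \<Rightarrow> 's \<Rightarrow> real" where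
  "generator S r x y = (if x = y then - (\<Sum>z\<in>S - {x}. r x z) else r x y)"

primrec generator_power :: "'s set \<Rightarrow> ('s \<Rightarrow> 's \<Rightarrow> real) \<Rightarrow> nat \<Rightarrow> 's \<Rightarrow> 's \<Rightarrow> real" where
  "generator_power S r 0 x y = (if x = y then 1 else 0)"
| "generator_power S r (Suc n) x y = (\<Sum>z\<in>S. generator S r x z * generator_power S r n z y)"

definition transition_prob :: "'s set \<Rightarrow> ('s \<Rightarrow> 's \<Rightarrow> real) \<Rightarrow> real \<Rightarrow> 's \<Rightarrow> 's \<Rightarrow> real" where
  "transition_prob S r t x y = (\<Sum>n. t ^ n / fact n * generator_power S r n x y)"

text \<open>
  The last conjunct is the Markov property with respect to the past of the process, written
  without conditional probabilities so that conditioning on null events needs no convention.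
  The law of \<open>X 0\<close> is left arbitrary.
\<close>

definition markov_jump_process ::
  "'w measure \<Rightarrow> 's::topological_space set \<Rightarrow> ('s \<Rightarrow> 's \<Rightarrow> real) \<Rightarrow> (real \<Rightarrow> 'w \<Rightarrow> 's) \<Rightarrow> bool" where
  "markov_jump_process M S r X \<longleftrightarrow>
     prob_space M \<and> finite S \<and>
     (\<forall>t\<ge>0. X t \<in> M \<rightarrow>\<^sub>M count_space S) \<and>
     (\<forall>w\<in>space M. cadlag (\<lambda>t. X t w)) \<and>
     (\<forall>n (t :: nat \<Rightarrow> real) (x :: nat \<Rightarrow> 's).
        0 \<le> t 0 \<and> (\<forall>i\<le>n. t i \<le> t (Suc i)) \<and> (\<forall>i\<le>Suc n. x i \<in> S) \<longrightarrow>
        measure M {w \<in> space M. \<forall>i\<le>Suc n. X (t i) w = x i} =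
        measure M {w \<in> space M. \<forall>i\<le>n. X (t i) w = x i}
          * transition_prob S r (t (Suc n) - t n) (x n) (x (Suc n)))"

section \<open>The storage network\<close>

text \<open>
  A vector \<open>(x\<^sub>0, \<dots>, x\<^sub>d)\<close> is represented by a function on \<open>nat\<close> that vanishes beyond \<open>d\<close>.
\<close>

definition network_states :: "nat \<Rightarrow> nat \<Rightarrow> (nat \<Rightarrow> nat) set" where
  "network_states d F = {x. (\<forall>i>d. x i = 0) \<and> (\<Sum>i\<le>d. x i) = F}"

text \<open>
  \<open>move a b x\<close> is \<open>x - e\<^sub>a + e\<^sub>b\<close>. The subtraction truncates if \<open>x a = 0\<close>, but all rates
  of such transitions are zero.
\<close>

definition move :: "nat \<Rightarrow> nat \<Rightarrow> (nat \<Rightarrow> nat) \<Rightarrow> nat \<Rightarrow> nat" where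
  "move a b x = x(a := x a - 1, b := x b + 1)"

definition network_rate ::
  "real \<Rightarrow> real \<Rightarrow> nat \<Rightarrow> nat \<Rightarrow> (nat \<Rightarrow> nat) \<Rightarrow> (nat \<Rightarrow> nat) \<Rightarrow> real" where
  "network_rate lam mu d N x y =
     (\<Sum>k = 1..d. if y = move k (k - 1) x then mu * real k * real (x k) else 0) +
     (\<Sum>k = 1..d - 1.
        if y = move k (k + 1) x \<and> x k > 0 \<and> (\<forall>i\<in>{1..<k}. x i = 0) then lam * real N else 0)"

section \<open>Convergence in distribution of processes\<close>

definition cadlag_paths :: "(real \<Rightarrow> 'a::topological_space) set" where
  "cadlag_paths = {f \<in> extensional {0..}. cadlag f}"

definition cadlag_space :: "(real \<Rightarrow> 'a::topological_space) measure" where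
  "cadlag_space = restrict_space (PiM {0..} (\<lambda>_. borel)) cadlag_paths"

definition compact_uniform_topology :: "(real \<Rightarrow> 'a::metric_space) topology" where
  "compact_uniform_topology = topology (\<lambda>U. U \<subseteq> cadlag_paths \<and>
     (\<forall>f\<in>U. \<exists>K e. compact K \<and> K \<subseteq> {0..} \<and> e > 0 \<and>
        {g \<in> cadlag_paths. \<forall>t\<in>K. dist (g t) (f t) < e} \<subseteq> U))"

lemma openin_compact_uniform_topology:
  "openin compact_uniform_topology (U :: (real \<Rightarrow> 'a::metric_space) set) \<longleftrightarrow> U \<subseteq> cadlag_paths \<and>
     (\<forall>f\<in>U. \<exists>K e. compact K \<and> K \<subseteq> {0..} \<and> e > 0 \<and>
        {g \<in> cadlag_paths. \<forall>t\<in>K. dist (g t) (f t) < e} \<subseteq> U)"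
proof -
  define B :: "(real \<Rightarrow> 'a) \<Rightarrow> real set \<Rightarrow> real \<Rightarrow> (real \<Rightarrow> 'a) set"
    where "B = (\<lambda>f K e. {g \<in> cadlag_paths. \<forall>t\<in>K. dist (g t) (f t) < e})"
  define P where "P = (\<lambda>U. U \<subseteq> cadlag_paths \<and>
     (\<forall>f\<in>U. \<exists>K e. compact K \<and> K \<subseteq> {0..} \<and> e > 0 \<and> B f K e \<subseteq> U))"
  have "P (U \<inter> V)" if U: "P U" and V: "P V" for U V
    unfolding P_def
  proof (intro conjI ballI)
    show "U \<inter> V \<subseteq> cadlag_paths" using U by (auto simp: P_def)
    fix f assume f: "f \<in> U \<inter> V"
    from U f have "\<exists>K e. compact K \<and> K \<subseteq> {0..} \<and> e > 0 \<and> B f K e \<subseteq> U"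
      unfolding P_def by simp
    then obtain K e where 1: "compact K" "K \<subseteq> {0..}" "e > 0" "B f K e \<subseteq> U"
      by (elim exE conjE)
    from V f have "\<exists>K e. compact K \<and> K \<subseteq> {0..} \<and> e > 0 \<and> B f K e \<subseteq> V"
      unfolding P_def by simp
    then obtain L d where 2: "compact L" "L \<subseteq> {0..}" "d > 0" "B f L d \<subseteq> V"
      by (elim exE conjE)
    have "B f (K \<union> L) (min e d) \<subseteq> B f K e \<inter> B f L d"
      unfolding B_def by auto
    also have "\<dots> \<subseteq> U \<inter> V"
      using 1(4) 2(4) by (rule Int_mono)
    finally have 3: "B f (K \<union> L) (min e d) \<subseteq> U \<inter> V" .
    show "\<exists>K e. compact K \<and> K \<subseteq> {0..} \<and> e > 0 \<and> B f K e \<subseteq> U \<inter> V"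
      by (rule exI[of _ "K \<union> L"], rule exI[of _ "min e d"])
        (use 1(1-3) 2(1-3) 3 in \<open>simp add: compact_Un\<close>)
  qed
  moreover have "P (\<Union>\<U>)" if "\<forall>U\<in>\<U>. P U" for \<U>
    unfolding P_def
  proof (intro conjI ballI)
    show "\<Union>\<U> \<subseteq> cadlag_paths" using that by (auto simp: P_def)
    fix f assume "f \<in> \<Union>\<U>"
    then obtain U where U: "U \<in> \<U>" "f \<in> U" by (elim UnionE)
    have "P U" using that U(1) by (rule bspec)
    then have "\<exists>K e. compact K \<and> K \<subseteq> {0..} \<and> e > 0 \<and> B f K e \<subseteq> U"
      using U(2) unfolding P_def by simp
    then obtain K e where 1: "compact K" "K \<subseteq> {0..}" "e > 0" "B f K e \<subseteq> U"
      by (elim exE conjE)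
    have "B f K e \<subseteq> \<Union>\<U>" using 1(4) U(1) by (rule order_trans[OF _ Union_upper])
    then show "\<exists>K e. compact K \<and> K \<subseteq> {0..} \<and> e > 0 \<and> B f K e \<subseteq> \<Union>\<U>"
      using 1(1-3) by (intro exI conjI)
  qed
  ultimately have "istopology P" unfolding istopology_def by simp
  then have "openin (topology P) U \<longleftrightarrow> P U" by (simp add: topology_inverse')
  then show ?thesis by (simp add: compact_uniform_topology_def P_def B_def)
qed

text \<open>
  Weak convergence of the laws of the processes \<open>Y N\<close>, defined on \<open>M N\<close>, to a probability
  measure \<open>L\<close> on path space. Since the topology is not separable, a continuous functional need
  not be measurable for the sigma-algebra generated by the evaluations \<open>f \<mapsto> f t\<close>; as usual,
  the test functionals are the bounded continuous ones that are.
\<close>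

definition converges_in_distribution ::
  "(nat \<Rightarrow> 'w measure) \<Rightarrow> (nat \<Rightarrow> 'w \<Rightarrow> real \<Rightarrow> 'a::metric_space)
     \<Rightarrow> (real \<Rightarrow> 'a) measure \<Rightarrow> bool" where
  "converges_in_distribution M Y L \<longleftrightarrow>
     (\<forall>\<^sub>F N in sequentially. prob_space (M N) \<and> Y N \<in> M N \<rightarrow>\<^sub>M cadlag_space) \<and>
     prob_space L \<and> sets L = sets cadlag_space \<and>
     (\<forall>\<Phi> :: (real \<Rightarrow> 'a) \<Rightarrow> real.
        \<Phi> \<in> borel_measurable cadlag_space \<and> bounded (\<Phi> ` cadlag_paths) \<and>
        continuous_map compact_uniform_topology euclideanreal \<Phi> \<longrightarrow>
        (\<lambda>N. \<integral>w. \<Phi> (Y N w) \<partial>M N) \<longlonglongrightarrow> (\<integral>f. \<Phi> f \<partial>L))"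

definition constant_process_law :: "'a::metric_space \<Rightarrow> (real \<Rightarrow> 'a) measure" where
  "constant_process_law c = return cadlag_space (\<lambda>t\<in>{0..}. c)"

end

theory Submission
  imports Defs
begin

text \<open>
  As long as \<open>X\<^sub>p > 0\<close> the duplication capacity \<open>\<lambda>N\<close> is fully used, so the total number of copies
  \<open>L = \<Sum> i X\<^sub>i\<close> is an \<open>M/M/\<infinity>\<close> queue and stays within \<open>\<epsilon>N\<close> of \<open>\<rho>N\<close> for a time exponential in \<open>N\<close>. The
  numbers \<open>L\<close>, \<open>X\<^sub>0\<close> and the workload \<open>W\<^sub>p\<^sub>-\<^sub>1\<close>, where \<open>W\<^sub>k = \<Sum>\<^sub>i\<^sub>\<le>\<^sub>k (k + 1 - i) X\<^sub>i\<close>, determine \<open>X\<^sub>p\<^sub>+\<^sub>1\<close>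
  and confine \<open>X\<^sub>p\<close>, so it remains to see that \<open>X\<^sub>0\<close> and \<open>W\<^sub>p\<^sub>-\<^sub>1\<close> are \<open>o(N)\<close> up to time \<open>N\<^sup>p\<^sup>-\<^sup>2 T\<close>. Each
  duplication at a level at most \<open>k\<close> lowers \<open>W\<^sub>k\<close> by one, at rate \<open>\<lambda>N\<close>, while \<open>W\<^sub>k\<close> grows at a rate of
  order \<open>W\<^sub>k\<^sub>+\<^sub>1\<close>; with \<open>\<phi>\<^sub>m(w) = \<Sum>\<^sub>i\<^sub>\<le>\<^sub>w i\<^sup>m\<close> the drift of \<open>N\<^sup>-\<^sup>k \<phi>\<^sub>k(W\<^sub>k)\<close> is thus at most of the form
  \<open>c N\<^sup>-\<^sup>k W\<^sub>k\<^sub>+\<^sub>1\<^sup>k\<^sup>+\<^sup>1 - c' N\<^sup>1\<^sup>-\<^sup>k W\<^sub>k\<^sup>k\<close>. These drifts telescope, and \<open>W\<^sub>p\<^sub>-\<^sub>1\<close> itself is a stable queue, so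
  \<open>X\<^sub>0 + \<Sum>\<^sub>k a\<^sub>k N\<^sup>-\<^sup>k \<phi>\<^sub>k(W\<^sub>k)\<close> has drift \<open>O(N\<^sup>2\<^sup>-\<^sup>p)\<close>. A maximal inequality for Lyapunov functions
  concludes.
\<close>

section \<open>The Kolmogorov equation and a maximal inequality\<close>

text \<open>The recursion multiplies by the generator on the left, while the forward equation needs
  it on the right; a matrix commutes with its powers.\<close>

lemma generator_power_Suc_right:
  assumes "finite S" "x \<in> S" "y \<in> S"
  shows "generator_power S r (Suc n) x y
    = (\<Sum>z\<in>S. generator_power S r n x z * generator S r z y)"
  using assms(2)
proof (induction n arbitrary: x)
  case 0
  have "(\<Sum>z\<in>S. generator S r x z * (if z = y then 1 else 0)) = generator S r x y"
    using assms by (simp add: if_distrib cong: if_cong)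
  moreover have "(\<Sum>z\<in>S. (if x = z then 1 else 0) * generator S r z y) = generator S r x y"
    using assms 0 by (simp add: if_distrib[of "\<lambda>a. a * _"] cong: if_cong)
  ultimately show ?case by simp
next
  case (Suc n)
  have "generator_power S r (Suc (Suc n)) x y
      = (\<Sum>u\<in>S. generator S r x u * (\<Sum>z\<in>S. generator_power S r n u z * generator S r z y))"
    using Suc.IH by (simp only: generator_power.simps(2)[of S r "Suc n"]) simp
  also have "\<dots> = (\<Sum>z\<in>S. (\<Sum>u\<in>S. generator S r x u * generator_power S r n u z) * generator S r z y)"
    by (simp add: sum_distrib_left sum_distrib_right mult.assoc) (rule sum.swap)
  finally show ?case by simp
qed

lemma generator_power_bound:
  assumes "\<And>x y. x \<in> S \<Longrightarrow> y \<in> S \<Longrightarrow> \<bar>generator S r x y\<bar> \<le> g" "x \<in> S" "y \<in> S"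
  shows "\<bar>generator_power S r n x y\<bar> \<le> (real (card S) * g) ^ n"
  using assms(2)
proof (induction n arbitrary: x)
  case (Suc n)
  have g: "g \<ge> 0" using assms(1)[OF assms(2,3)] by linarith
  have "\<bar>generator_power S r (Suc n) x y\<bar>
      \<le> (\<Sum>z\<in>S. \<bar>generator S r x z\<bar> * \<bar>generator_power S r n z y\<bar>)"
    by (simp flip: abs_mult)
  also have "\<dots> \<le> (\<Sum>z\<in>S. g * (real (card S) * g) ^ n)"
    using Suc.IH Suc.prems g by (intro sum_mono mult_mono assms(1)) auto
  finally show ?case by (simp add: mult.assoc)
qed simp

lemma summable_transition_prob:
  assumes "finite S" "x \<in> S" "y \<in> S"
  shows "summable (\<lambda>n. generator_power S r n x y / fact n * t ^ n)"
proof -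
  define g where "g = (\<Sum>x\<in>S. \<Sum>y\<in>S. \<bar>generator S r x y\<bar>)"
  have "\<bar>generator S r x y\<bar> \<le> g" if "x \<in> S" "y \<in> S" for x y
  proof -
    have "\<bar>generator S r x y\<bar> \<le> (\<Sum>y\<in>S. \<bar>generator S r x y\<bar>)"
      using that assms(1) by (intro member_le_sum) auto
    also have "\<dots> \<le> g" unfolding g_def
      using that assms(1) by (intro member_le_sum) (auto intro: sum_nonneg)
    finally show ?thesis .
  qed
  note bound = generator_power_bound[OF this assms(2,3)]
  have "norm (generator_power S r n x y / fact n * t ^ n)
      \<le> inverse (fact n) * (real (card S) * g * \<bar>t\<bar>) ^ n" for n
  proof -
    have "\<bar>generator_power S r n x y\<bar> * \<bar>t\<bar> ^ n \<le> (real (card S) * g) ^ n * \<bar>t\<bar> ^ n"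
      by (intro mult_right_mono bound) auto
    then show ?thesis
      by (simp add: abs_mult power_abs power_mult_distrib field_simps)
  qed
  then show ?thesis
    by (rule summable_comparison_test'[OF summable_exp, of 0])
qed

text \<open>The forward Kolmogorov equation, by termwise differentiation: \<open>diffs\<close>
  shifts the coefficients by one power of the generator.\<close>

lemma transition_prob_has_derivative:
  assumes "finite S" "x \<in> S" "y \<in> S"
  shows "((\<lambda>t. transition_prob S r t x y) has_real_derivative
    (\<Sum>z\<in>S. transition_prob S r t x z * generator S r z y)) (at t)"
proof -
  let ?c = "\<lambda>y n. generator_power S r n x y / fact n"
  have tp: "transition_prob S r t x y = (\<Sum>n. ?c y n * t ^ n)" for t y
    unfolding transition_prob_def by (simp add: mult.commute)
  have d: "diffs (?c y) n = (\<Sum>z\<in>S. ?c z n * generator S r z y)" for n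
    unfolding diffs_def generator_power_Suc_right[OF assms]
    by (simp add: sum_divide_distrib sum_distrib_left field_simps del: of_nat_Suc)
  have "(\<Sum>n. diffs (?c y) n * t ^ n) = (\<Sum>n. \<Sum>z\<in>S. ?c z n * t ^ n * generator S r z y)"
    unfolding d by (simp add: sum_distrib_left mult_ac)
  also have "\<dots> = (\<Sum>z\<in>S. \<Sum>n. ?c z n * t ^ n * generator S r z y)"
    using assms by (intro suminf_sum summable_mult2 summable_transition_prob)
  also have "\<dots> = (\<Sum>z\<in>S. transition_prob S r t x z * generator S r z y)"
    unfolding tp using assms
    by (intro sum.cong refl suminf_mult2[symmetric] summable_transition_prob)
  finally show ?thesis
    using termdiffs_strong_converges_everywhere[OF summable_transition_prob[OF assms], of r t]
    by (simp add: tp)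
qed

section \<open>The Markov property for path events and Dynkin's inequality\<close>

locale markov_jump =
  fixes M :: "'w measure" and S :: "'s::topological_space set"
    and r :: "'s \<Rightarrow> 's \<Rightarrow> real" and X :: "real \<Rightarrow> 'w \<Rightarrow> 's"
  assumes process: "markov_jump_process M S r X"
begin

sublocale prob_space M
  using process unfolding markov_jump_process_def by blast

lemma finite_S: "finite S"
  using process unfolding markov_jump_process_def by blast

lemma measurable_X: "t \<ge> 0 \<Longrightarrow> X t \<in> M \<rightarrow>\<^sub>M count_space S"
  using process unfolding markov_jump_process_def by blast

lemma X_in: "t \<ge> 0 \<Longrightarrow> w \<in> space M \<Longrightarrow> X t w \<in> S"
  using measurable_space[OF measurable_X] by simp

lemma cadlag_X: "w \<in> space M \<Longrightarrow> cadlag (\<lambda>t. X t w)"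
  using process unfolding markov_jump_process_def by blast

lemma markov_property:
  assumes "0 \<le> t 0" "\<And>i. i \<le> n \<Longrightarrow> t i \<le> t (Suc i)" "\<And>i. i \<le> Suc n \<Longrightarrow> x i \<in> S"
  shows "prob {w \<in> space M. \<forall>i\<le>Suc n. X (t i) w = x i} =
    prob {w \<in> space M. \<forall>i\<le>n. X (t i) w = x i}
      * transition_prob S r (t (Suc n) - t n) (x n) (x (Suc n))"
  using process assms unfolding markov_jump_process_def by blast

lemma events_X: "t \<ge> 0 \<Longrightarrow> {w \<in> space M. X t w \<in> D} \<in> events"
proof -
  assume t: "t \<ge> 0"
  have "{w \<in> space M. X t w \<in> D} = X t -` (D \<inter> S) \<inter> space M"
    using X_in[OF t] by auto
  then show ?thesis using measurable_sets[OF measurable_X[OF t], of "D \<inter> S"] by simp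
qed

lemma events_path:
  fixes t :: "nat \<Rightarrow> real"
  assumes "\<And>i. i \<le> n \<Longrightarrow> t i \<ge> 0"
  shows "{w \<in> space M. \<forall>i\<le>n. X (t i) w \<in> C i} \<in> events"
proof -
  have "{w \<in> space M. \<forall>i\<in>{..n}. X (t i) w \<in> C i} \<in> events"
    using events_X[OF assms] by (intro sets.sets_Collect_finite_All') simp_all
  then show ?thesis unfolding Ball_def atMost_iff .
qed

lemma prob_split:
  assumes "s \<ge> 0" "E \<in> events"
  shows "prob E = (\<Sum>y\<in>S. prob (E \<inter> {w \<in> space M. X s w = y}))"
proof -
  have ev: "{w \<in> space M. X s w = y} \<in> events" for y
    using events_X[OF assms(1), of "{y}"] by simp
  have "E = (\<Union>y\<in>S. E \<inter> {w \<in> space M. X s w = y})"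
    using X_in[OF assms(1)] sets.sets_into_space[OF assms(2)] by auto
  then have "prob E = prob (\<Union>y\<in>S. E \<inter> {w \<in> space M. X s w = y})" by simp
  also have "\<dots> = (\<Sum>y\<in>S. prob (E \<inter> {w \<in> space M. X s w = y}))"
    using finite_S ev assms(2)
    by (intro finite_measure_finite_Union) (auto simp: disjoint_family_on_def)
  finally show ?thesis .
qed

text \<open>The Markov property speaks of exact paths, the exit argument of paths confined to sets;
  the finite set \<open>PiE {..n} C\<close> of paths links the two.\<close>

lemma prob_split_path:
  fixes t :: "nat \<Rightarrow> real"
  assumes "\<And>i. i \<le> n \<Longrightarrow> t i \<ge> 0" "E \<in> events" "\<And>i. C i \<subseteq> S"
  shows "prob (E \<inter> {w \<in> space M. \<forall>i\<le>n. X (t i) w \<in> C i})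
    = (\<Sum>\<xi>\<in>PiE {..n} C. prob (E \<inter> {w \<in> space M. \<forall>i\<le>n. X (t i) w = \<xi> i}))"
proof -
  have ev: "{w \<in> space M. \<forall>i\<le>n. X (t i) w = \<xi> i} \<in> events" for \<xi>
  proof -
    have "{w \<in> space M. \<forall>i\<le>n. X (t i) w \<in> {\<xi> i}} \<in> events"
      by (rule events_path) (rule assms(1))
    then show ?thesis unfolding singleton_iff .
  qed
  have fin: "finite (PiE {..n} C)"
    using finite_subset[OF assms(3) finite_S] by (simp add: finite_PiE)
  have "E \<inter> {w \<in> space M. \<forall>i\<le>n. X (t i) w \<in> C i}
      = (\<Union>\<xi>\<in>PiE {..n} C. E \<inter> {w \<in> space M. \<forall>i\<le>n. X (t i) w = \<xi> i})" (is "?A = ?B")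
  proof
    show "?A \<subseteq> ?B"
    proof
      fix w assume "w \<in> ?A"
      then show "w \<in> ?B"
        by (intro UN_I[of "restrict (\<lambda>i. X (t i) w) {..n}"]) auto
    qed
  qed (auto simp: PiE_def)
  then have "prob ?A = prob ?B" by simp
  also have "\<dots> = (\<Sum>\<xi>\<in>PiE {..n} C. prob (E \<inter> {w \<in> space M. \<forall>i\<le>n. X (t i) w = \<xi> i}))"
  proof (intro finite_measure_finite_Union fin)
    show "disjoint_family_on (\<lambda>\<xi>. E \<inter> {w \<in> space M. \<forall>i\<le>n. X (t i) w = \<xi> i}) (PiE {..n} C)"
      unfolding disjoint_family_on_def
    proof (intro ballI impI)
      fix \<xi> \<zeta> assume *: "\<xi> \<in> PiE {..n} C" "\<zeta> \<in> PiE {..n} C" "\<xi> \<noteq> \<zeta>"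
      then obtain i where "i \<le> n" "\<xi> i \<noteq> \<zeta> i" by (metis PiE_ext atMost_iff)
      then have no: "\<not> ((\<forall>i\<le>n. X (t i) w = \<xi> i) \<and> (\<forall>i\<le>n. X (t i) w = \<zeta> i))" for w
        by metis
      then show "E \<inter> {w \<in> space M. \<forall>i\<le>n. X (t i) w = \<xi> i}
          \<inter> (E \<inter> {w \<in> space M. \<forall>i\<le>n. X (t i) w = \<zeta> i}) = {}"
        using no by (auto simp only: disjoint_iff Int_iff mem_Collect_eq)
    qed
    show "(\<lambda>\<xi>. E \<inter> {w \<in> space M. \<forall>i\<le>n. X (t i) w = \<xi> i}) ` PiE {..n} C \<subseteq> events"
      by (intro image_subsetI sets.Int assms(2) ev)
  qed
  finally show ?thesis .
qed

text \<open>The Markov property for a past confined to the sets \<open>C\<close>: apply it to each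
  exact path, then group the paths by their endpoint at \<open>t n\<close>.\<close>

lemma prob_path_step:
  assumes t: "0 \<le> t 0" "\<And>i. i < n \<Longrightarrow> t i \<le> t (Suc i)" and s: "t n \<le> s"
    and C: "\<And>i. C i \<subseteq> S" and y: "y \<in> S"
  defines "A \<equiv> {w \<in> space M. \<forall>i\<le>n. X (t i) w \<in> C i}"
  shows "prob (A \<inter> {w \<in> space M. X s w = y})
    = (\<Sum>x\<in>S. prob (A \<inter> {w \<in> space M. X (t n) w = x}) * transition_prob S r (s - t n) x y)"
proof -
  define B where "B = (\<lambda>\<xi>. {w \<in> space M. \<forall>i\<le>n. X (t i) w = \<xi> i})"
  have pos: "t i \<ge> 0" if "i \<le> n" for i
    using that t(1) by (induction i) (auto intro: order_trans[OF _ t(2)])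
  have ev: "{w \<in> space M. X u w = y} \<in> events" if "u \<ge> 0" for u y
    using events_X[OF that, of "{y}"] by simp
  have split: "prob (A \<inter> E) = (\<Sum>\<xi>\<in>PiE {..n} C. prob (E \<inter> B \<xi>))" if "E \<in> events" for E
    unfolding A_def B_def using prob_split_path[OF pos that C] by (simp add: Int_commute)
  have step: "prob ({w \<in> space M. X s w = y} \<inter> B \<xi>)
      = prob (B \<xi>) * transition_prob S r (s - t n) (\<xi> n) y" if "\<xi> \<in> PiE {..n} C" for \<xi>
  proof -
    have "prob {w \<in> space M. \<forall>i\<le>Suc n. X ((t(Suc n := s)) i) w = (\<xi>(Suc n := y)) i} =
      prob {w \<in> space M. \<forall>i\<le>n. X ((t(Suc n := s)) i) w = (\<xi>(Suc n := y)) i}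
      * transition_prob S r ((t(Suc n := s)) (Suc n) - (t(Suc n := s)) n)
          ((\<xi>(Suc n := y)) n) ((\<xi>(Suc n := y)) (Suc n))"
    proof (rule markov_property)
      show "(\<xi>(Suc n := y)) i \<in> S" if "i \<le> Suc n" for i
        using that y C \<open>\<xi> \<in> PiE {..n} C\<close> by (auto simp: le_Suc_eq)
    qed (use t s in \<open>auto simp: le_less\<close>)
    moreover have "{w \<in> space M. \<forall>i\<le>Suc n. X ((t(Suc n := s)) i) w = (\<xi>(Suc n := y)) i}
        = {w \<in> space M. X s w = y} \<inter> B \<xi>"
      unfolding B_def by (auto simp: le_Suc_eq)
    moreover have "{w \<in> space M. \<forall>i\<le>n. X ((t(Suc n := s)) i) w = (\<xi>(Suc n := y)) i} = B \<xi>"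
      unfolding B_def by (auto cong: conj_cong)
    ultimately show ?thesis by simp
  qed
  have fin: "finite (PiE {..n} C)"
    using finite_subset[OF C finite_S] by (simp add: finite_PiE)
  have "(\<Sum>x\<in>S. prob (A \<inter> {w \<in> space M. X (t n) w = x}) * transition_prob S r (s - t n) x y)
      = (\<Sum>x\<in>S. \<Sum>\<xi>\<in>PiE {..n} C. prob ({w \<in> space M. X (t n) w = x} \<inter> B \<xi>)
          * transition_prob S r (s - t n) x y)"
    by (intro sum.cong refl) (simp add: split[OF ev[OF pos[OF order_refl]]] sum_distrib_right)
  also have "\<dots> = (\<Sum>\<xi>\<in>PiE {..n} C. \<Sum>x\<in>S. prob ({w \<in> space M. X (t n) w = x} \<inter> B \<xi>)
          * transition_prob S r (s - t n) x y)"
    by (rule sum.swap)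
  also have "\<dots> = (\<Sum>\<xi>\<in>PiE {..n} C. prob (B \<xi>) * transition_prob S r (s - t n) (\<xi> n) y)"
  proof (rule sum.cong[OF refl])
    fix \<xi> assume "\<xi> \<in> PiE {..n} C"
    then have \<xi>: "\<xi> n \<in> S" using C by blast
    have "{w \<in> space M. X (t n) w = x} \<inter> B \<xi> = (if x = \<xi> n then B \<xi> else {})" for x
      unfolding B_def by auto
    then have "(\<Sum>x\<in>S. prob ({w \<in> space M. X (t n) w = x} \<inter> B \<xi>)
        * transition_prob S r (s - t n) x y)
      = (\<Sum>x\<in>S. if x = \<xi> n then prob (B \<xi>) * transition_prob S r (s - t n) x y else 0)"
      by (intro sum.cong refl) auto
    then show "(\<Sum>x\<in>S. prob ({w \<in> space M. X (t n) w = x} \<inter> B \<xi>)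
        * transition_prob S r (s - t n) x y)
      = prob (B \<xi>) * transition_prob S r (s - t n) (\<xi> n) y"
      using \<xi> finite_S by simp
  qed
  also have "\<dots> = (\<Sum>\<xi>\<in>PiE {..n} C. prob ({w \<in> space M. X s w = y} \<inter> B \<xi>))"
    by (intro sum.cong refl) (simp add: step)
  also have "\<dots> = prob (A \<inter> {w \<in> space M. X s w = y})"
    using split[OF ev[of s y]] pos[of n] s by auto
  finally show ?thesis by simp
qed

text \<open>Dynkin's formula restricted to a past event: by the forward equation the derivative in
  \<open>s\<close> is the expectation of the generator applied to \<open>h\<close>, which is at most
  \<open>c\<close> pointwise.\<close>

lemma expected_drift_bound:
  assumes t: "0 \<le> t 0" "\<And>i. i < n \<Longrightarrow> t i \<le> t (Suc i)" and s: "t n \<le> s"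
    and C: "\<And>i. C i \<subseteq> S"
    and drift: "\<And>x. x \<in> S \<Longrightarrow> (\<Sum>y\<in>S. generator S r x y * h y) \<le> c"
  defines "A \<equiv> {w \<in> space M. \<forall>i\<le>n. X (t i) w \<in> C i}"
  shows "(\<Sum>y\<in>S. h y * prob (A \<inter> {w \<in> space M. X s w = y}))
    \<le> (\<Sum>y\<in>S. h y * prob (A \<inter> {w \<in> space M. X (t n) w = y})) + c * (s - t n) * prob A"
proof -
  have pos: "t i \<ge> 0" if "i \<le> n" for i
    using that t(1) by (induction i) (auto intro: order_trans[OF _ t(2)])
  have A: "A \<in> events" unfolding A_def by (intro events_path pos)
  define q where "q = (\<lambda>x. prob (A \<inter> {w \<in> space M. X (t n) w = x}))"
  define u where "u = (\<lambda>s y. prob (A \<inter> {w \<in> space M. X s w = y}))"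
  have u: "u s y = (\<Sum>x\<in>S. q x * transition_prob S r (s - t n) x y)" if "y \<in> S" "t n \<le> s" for s y
    using prob_path_step[OF t that(2) C that(1)] unfolding u_def q_def A_def by simp
  \<comment> \<open>Written with the matrix exponential, so that the two-sided derivative exists
    also at the endpoint \<open>t n\<close>, before which \<open>u\<close> has no such
    formula.\<close>
  define v where "v = (\<lambda>s. (\<Sum>y\<in>S. h y * (\<Sum>x\<in>S. q x * transition_prob S r (s - t n) x y))
      - c * (s - t n) * prob A)"
  have "v (t n) \<ge> v s"
  proof (rule DERIV_nonpos_imp_nonincreasing[OF s])
    fix \<tau> assume \<tau>: "t n \<le> \<tau>" "\<tau> \<le> s"
    let ?D = "(\<Sum>y\<in>S. h y * (\<Sum>x\<in>S. q x * (\<Sum>z\<in>S. transition_prob S r (\<tau> - t n) x z * generator S r z y)))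
      - c * prob A"
    have "((\<lambda>s. transition_prob S r (s - t n) x y) has_real_derivative
        (\<Sum>z\<in>S. transition_prob S r (\<tau> - t n) x z * generator S r z y)) (at \<tau>)"
      if "x \<in> S" "y \<in> S" for x y
      using transition_prob_has_derivative[OF finite_S that, of r "\<tau> - t n"]
        DERIV_shift[of "\<lambda>s. transition_prob S r s x y" _ \<tau> "- t n"]
      by simp
    then have "(v has_real_derivative ?D) (at \<tau>)"
      unfolding v_def by (auto intro!: derivative_eq_intros DERIV_sum simp: mult.commute)
    \<comment> \<open>The sums are reordered to move the generator from the transition probabilities
      onto \<open>h\<close>.\<close>
    moreover have "(\<Sum>y\<in>S. h y * (\<Sum>x\<in>S. q x * (\<Sum>z\<in>S. transition_prob S r (\<tau> - t n) x z * generator S r z y)))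
        = (\<Sum>y\<in>S. \<Sum>x\<in>S. \<Sum>z\<in>S. q x * transition_prob S r (\<tau> - t n) x z * (generator S r z y * h y))"
      by (simp add: sum_distrib_left mult_ac)
    moreover have "\<dots> = (\<Sum>y\<in>S. \<Sum>z\<in>S. \<Sum>x\<in>S. q x * transition_prob S r (\<tau> - t n) x z * (generator S r z y * h y))"
      by (rule sum.cong[OF refl], rule sum.swap)
    moreover have "\<dots> = (\<Sum>z\<in>S. \<Sum>y\<in>S. \<Sum>x\<in>S. q x * transition_prob S r (\<tau> - t n) x z * (generator S r z y * h y))"
      by (rule sum.swap)
    moreover have "\<dots> = (\<Sum>z\<in>S. u \<tau> z * (\<Sum>y\<in>S. generator S r z y * h y))"
    proof (rule sum.cong[OF refl])
      fix z assume "z \<in> S"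
      then show "(\<Sum>y\<in>S. \<Sum>x\<in>S. q x * transition_prob S r (\<tau> - t n) x z * (generator S r z y * h y))
          = u \<tau> z * (\<Sum>y\<in>S. generator S r z y * h y)"
        using \<tau>(1) by (simp only: u sum_product) (rule sum.swap)
    qed
    moreover have "\<dots> \<le> (\<Sum>z\<in>S. u \<tau> z * c)"
      by (intro sum_mono mult_left_mono drift) (auto simp: u_def)
    moreover have "\<dots> = c * prob A"
      using prob_split[OF _ A, of \<tau>] pos[of n] \<tau> by (simp add: u_def sum_distrib_left mult.commute)
    ultimately show "\<exists>D. (v has_real_derivative D) (at \<tau>) \<and> D \<le> 0"
      by (intro exI[of _ ?D]) simp
  qed
  moreover have v: "v s = (\<Sum>y\<in>S. h y * u s y) - c * (s - t n) * prob A" if "t n \<le> s" for s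
    unfolding v_def using that by (simp add: u)
  ultimately show ?thesis using v[OF s] v[OF order_refl] by (simp add: u_def)
qed

section \<open>Truncated Lyapunov functions and maximal inequalities\<close>

text \<open>
  Truncating the Lyapunov function \<open>f\<close> at the level \<open>1\<close> makes the drift bound global: outside
  \<open>{f < 1}\<close> the truncated function is maximal, so its drift is nonpositive there.
\<close>

lemma truncated_drift:
  assumes r: "\<And>x y. x \<in> S \<Longrightarrow> y \<in> S \<Longrightarrow> r x y \<ge> 0" and c: "c \<ge> 0"
    and f: "\<And>x. x \<in> S \<Longrightarrow> f x < 1 \<Longrightarrow> (\<Sum>y\<in>S. r x y * (f y - f x)) \<le> c" and x: "x \<in> S"
  shows "(\<Sum>y\<in>S. generator S r x y * min (f y) 1) \<le> c"
proof -
  have "(\<Sum>y\<in>S. generator S r x y * min (f y) 1)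
      = generator S r x x * min (f x) 1 + (\<Sum>y\<in>S - {x}. generator S r x y * min (f y) 1)"
    using finite_S x by (rule sum.remove)
  also have "\<dots> = (\<Sum>y\<in>S - {x}. r x y * (min (f y) 1 - min (f x) 1))"
  proof -
    have "(\<Sum>y\<in>S - {x}. generator S r x y * min (f y) 1) = (\<Sum>y\<in>S - {x}. r x y * min (f y) 1)"
      by (intro sum.cong) (auto simp: generator_def)
    then show ?thesis
      by (simp add: generator_def sum_distrib_right right_diff_distrib sum_subtractf)
  qed
  also have "\<dots> = (\<Sum>y\<in>S. r x y * (min (f y) 1 - min (f x) 1))"
    using finite_S x by (simp add: sum.remove)
  also have "\<dots> \<le> c"
  proof (cases "f x < 1")
    case True
    have "(\<Sum>y\<in>S. r x y * (min (f y) 1 - min (f x) 1)) \<le> (\<Sum>y\<in>S. r x y * (f y - f x))"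
      using True x by (intro sum_mono mult_left_mono r) auto
    with f[OF x True] show ?thesis by simp
  next
    case False
    have "(\<Sum>y\<in>S. r x y * (min (f y) 1 - min (f x) 1)) \<le> 0"
      using False x by (intro sum_nonpos mult_nonneg_nonpos r) auto
    with c show ?thesis by simp
  qed
  finally show ?thesis .
qed

lemma initial_state:
  assumes "AE w in M. X 0 w = x0"
  shows "x0 \<in> S"
proof (rule ccontr)
  assume "x0 \<notin> S"
  have "AE w in M. False"
    using assms by (rule AE_mp) (rule AE_I2, use X_in[of 0] \<open>x0 \<notin> S\<close> in auto)
  then show False by simp
qed

text \<open>Induction on the exit probability plus the expectation of the truncated \<open>f\<close>
  on the event of no exit. Mass that leaves \<open>{f < 1}\<close> carries the truncated value 1 and
  just passes from the second term to the first; only the drift adds to the sum.\<close>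

lemma discrete_maximal_inequality:
  assumes r: "\<And>x y. x \<in> S \<Longrightarrow> y \<in> S \<Longrightarrow> r x y \<ge> 0" and c: "c \<ge> 0"
    and f_nonneg: "\<And>x. x \<in> S \<Longrightarrow> f x \<ge> 0"
    and f: "\<And>x. x \<in> S \<Longrightarrow> f x < 1 \<Longrightarrow> (\<Sum>y\<in>S. r x y * (f y - f x)) \<le> c"
    and init: "AE w in M. X 0 w = x0"
    and t: "t 0 = 0" "\<And>i. t i \<le> t (Suc i)"
  shows "prob (space M - {w \<in> space M. \<forall>i\<le>n. f (X (t i) w) < 1}) \<le> f x0 + c * t n"
proof -
  define h where "h = (\<lambda>x. min (f x) 1)"
  define D where "D = {x \<in> S. f x < 1}"
  define A where "A = (\<lambda>n. {w \<in> space M. \<forall>i\<le>n. X (t i) w \<in> D})"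
  define E where "E = (\<lambda>s y. {w \<in> space M. X s w = y})"
  have pos: "t i \<ge> 0" for i
    using lift_Suc_mono_le[of t 0 i] t by simp
  have E: "E s y \<in> events" if "s \<ge> 0" for s y
    using events_X[OF that, of "{y}"] by (simp add: E_def)
  have A: "A n \<in> events" for n
    unfolding A_def by (rule events_path[OF pos])
  have h_nonneg: "h x \<ge> 0" if "x \<in> S" for x using f_nonneg[OF that] by (simp add: h_def)
  \<comment> \<open>Stated for any event \<open>B\<close> because it serves twice: with the whole
    space at time 0 and with \<open>A n\<close> in the induction step.\<close>
  have exit: "(\<Sum>y\<in>S. h y * prob (B \<inter> E s y))
      \<ge> (\<Sum>y\<in>S. h y * prob (B \<inter> {w \<in> space M. X s w \<in> D} \<inter> E s y))
        + prob (B - {w \<in> space M. X s w \<in> D})"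
    if "B \<in> events" "s \<ge> 0" for B s
  proof -
    let ?G = "{w \<in> space M. X s w \<in> D}"
    have G: "?G \<in> events" using that by (intro events_X)
    have eq: "prob (B - ?G) = (\<Sum>y\<in>S. prob ((B - ?G) \<inter> E s y))"
      unfolding E_def using that G by (intro prob_split) auto
    have *: "h y * prob (B \<inter> ?G \<inter> E s y) + prob ((B - ?G) \<inter> E s y) \<le> h y * prob (B \<inter> E s y)"
      if "y \<in> S" for y
    proof (cases "y \<in> D")
      case True
      then have "B \<inter> ?G \<inter> E s y = B \<inter> E s y" "(B - ?G) \<inter> E s y = {}" by (auto simp: E_def)
      then show ?thesis by simp
    next
      case False
      then have "B \<inter> ?G \<inter> E s y = {}" "(B - ?G) \<inter> E s y = B \<inter> E s y" by (auto simp: E_def)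
      moreover have "h y = 1" using False that by (simp add: h_def D_def)
      ultimately show ?thesis by simp
    qed
    show ?thesis unfolding eq sum.distrib[symmetric] by (intro sum_mono *)
  qed
  have "prob (space M - A n) + (\<Sum>y\<in>S. h y * prob (A n \<inter> E (t n) y)) \<le> f x0 + c * t n"
  proof (induction n)
    case 0
    have A0: "A 0 = space M \<inter> {w \<in> space M. X (t 0) w \<in> D}" by (auto simp: A_def)
    have "prob (E 0 y) = (if y = x0 then 1 else 0)" for y
    proof (cases "y = x0")
      case True
      then show ?thesis using init E[of 0 y] by (simp add: E_def prob_Collect_eq_1)
    next
      case False
      then have "AE w in M. w \<notin> E 0 y" using init by (auto simp: E_def)
      then have "prob (E 0 y) = 0" using E[of 0 y] by (simp add: prob_eq_0)
      then show ?thesis using False by simp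
    qed
    moreover have "space M \<inter> E s y = E s y" for s y by (auto simp: E_def)
    ultimately have "(\<Sum>y\<in>S. h y * prob (space M \<inter> E (t 0) y)) = (\<Sum>y\<in>S. if y = x0 then h y else 0)"
      by (intro sum.cong) (auto simp: t)
    also have "\<dots> \<le> f x0"
      using initial_state[OF init] finite_S by (simp add: h_def)
    finally show ?case
      using exit[of "space M" "t 0"] pos[of 0] unfolding A0 Diff_Int Diff_cancel Un_empty_left
      by (simp add: t(1))
  next
    case (Suc n)
    have AS: "A (Suc n) = A n \<inter> {w \<in> space M. X (t (Suc n)) w \<in> D}"
      by (auto simp: A_def le_Suc_eq)
    have "(\<Sum>y\<in>S. h y * prob (A n \<inter> E (t (Suc n)) y))
      \<le> (\<Sum>y\<in>S. h y * prob (A n \<inter> E (t n) y)) + c * (t (Suc n) - t n) * prob (A n)"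
      unfolding A_def E_def
    proof (rule expected_drift_bound)
      show "(\<Sum>y\<in>S. generator S r x y * h y) \<le> c" if "x \<in> S" for x
        unfolding h_def using r c f that by (rule truncated_drift)
    qed (simp_all add: t D_def)
    also have "c * (t (Suc n) - t n) * prob (A n) \<le> c * (t (Suc n) - t n)"
      using c t(2)[of n] by (intro mult_left_le) auto
    finally have 1: "(\<Sum>y\<in>S. h y * prob (A n \<inter> E (t (Suc n)) y))
      \<le> (\<Sum>y\<in>S. h y * prob (A n \<inter> E (t n) y)) + c * (t (Suc n) - t n)" by simp
    have "prob (space M - A (Suc n))
        = prob ((space M - A n) \<union> (A n - {w \<in> space M. X (t (Suc n)) w \<in> D}))"
      unfolding AS by (intro arg_cong[where f=prob]) (auto simp: A_def)
    also have "\<dots> = prob (space M - A n) + prob (A n - {w \<in> space M. X (t (Suc n)) w \<in> D})"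
      using A[of n] events_X[OF pos[of "Suc n"], of D] by (intro finite_measure_Union) auto
    finally show ?case
      using 1 Suc exit[OF A[of n] pos[of "Suc n"]] unfolding AS by (simp add: algebra_simps)
  qed
  moreover have "(\<Sum>y\<in>S. h y * prob (A n \<inter> E (t n) y)) \<ge> 0"
    by (intro sum_nonneg mult_nonneg_nonneg h_nonneg) auto
  moreover have "A n = {w \<in> space M. \<forall>i\<le>n. f (X (t i) w) < 1}"
    using X_in[OF pos] by (auto simp: A_def D_def)
  ultimately show ?thesis by simp
qed

text \<open>
  Discreteness of \<open>S\<close> makes the paths piecewise constant from the right, so that a visit to
  \<open>{f \<ge> 1}\<close> is seen on a dyadic grid.
\<close>

lemma maximal_inequality:
  assumes r: "\<And>x y. x \<in> S \<Longrightarrow> y \<in> S \<Longrightarrow> r x y \<ge> 0" and c: "c \<ge> 0"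
    and f_nonneg: "\<And>x. x \<in> S \<Longrightarrow> f x \<ge> 0"
    and f: "\<And>x. x \<in> S \<Longrightarrow> f x < 1 \<Longrightarrow> (\<Sum>y\<in>S. r x y * (f y - f x)) \<le> c"
    and init: "AE w in M. X 0 w = x0"
    and discrete: "\<And>x. x \<in> S \<Longrightarrow> \<exists>U. open U \<and> U \<inter> S = {x}"
    and T: "T > 0"
  shows "\<exists>E\<in>events. prob E \<le> f x0 + c * T
    \<and> (\<forall>w\<in>space M - E. \<forall>t. 0 \<le> t \<longrightarrow> t < T \<longrightarrow> f (X t w) < 1)"
proof -
  \<comment> \<open>Dyadic grids are nested, so the bad events \<open>E m\<close> increase and their
    union inherits the uniform bound.\<close>
  define s where "s = (\<lambda>m i. T * real i / 2 ^ m)"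
  define E where "E = (\<lambda>m. space M - {w \<in> space M. \<forall>i\<le>2 ^ m. f (X (s m i) w) < 1})"
  have s: "s m i \<ge> 0" for m i using T by (simp add: s_def)
  have bound: "prob (E m) \<le> f x0 + c * T" for m
    unfolding E_def
    using discrete_maximal_inequality[OF r c f_nonneg f init, of "s m" "2 ^ m"] T
    by (simp add: s_def field_simps)
  have ev: "E m \<in> events" for m
  proof -
    have "{w \<in> space M. \<forall>i\<le>2 ^ m. X (s m i) w \<in> {x. f x < 1}} \<in> events"
      by (intro events_path s)
    then show ?thesis unfolding E_def mem_Collect_eq by (rule sets.compl_sets)
  qed
  have E_iff: "w \<in> E m \<longleftrightarrow> w \<in> space M \<and> (\<exists>i\<le>2 ^ m. \<not> f (X (s m i) w) < 1)" for w m
    by (auto simp: E_def)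
  have "E m \<subseteq> E (Suc m)" for m
  proof
    fix w assume "w \<in> E m"
    then obtain i where i: "w \<in> space M" "i \<le> 2 ^ m" "\<not> f (X (s m i) w) < 1"
      unfolding E_iff by blast
    have "s (Suc m) (2 * i) = s m i" by (simp add: s_def)
    moreover have "2 * i \<le> 2 ^ Suc m" using i(2) by simp
    ultimately show "w \<in> E (Suc m)" unfolding E_iff using i by metis
  qed
  then have "incseq E" by (rule incseq_SucI)
  then have "(\<lambda>m. prob (E m)) \<longlonglongrightarrow> prob (\<Union>m. E m)"
    using ev by (intro finite_Lim_measure_incseq) auto
  then have "prob (\<Union>m. E m) \<le> f x0 + c * T"
    using bound by (intro LIMSEQ_le_const2) auto
  moreover have "f (X t w) < 1" if w: "w \<in> space M - (\<Union>m. E m)" and t: "0 \<le> t" "t < T" for w t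
  proof -
    have wM: "w \<in> space M" and wE: "\<And>m. w \<notin> E m" using w by simp_all
    obtain U where U: "open U" "U \<inter> S = {X t w}"
      using discrete[OF X_in[OF t(1) wM]] by (elim exE conjE)
    have "((\<lambda>t. X t w) \<longlongrightarrow> X t w) (at_right t)"
      using cadlag_X[OF wM] t(1) unfolding cadlag_def by simp
    then have "\<forall>\<^sub>F u in at_right t. X u w \<in> U"
      using U by (intro topological_tendstoD) auto
    then obtain b where b: "b > t" "\<And>u. t < u \<Longrightarrow> u < b \<Longrightarrow> X u w \<in> U"
      unfolding eventually_at_right[OF t(2)] by blast
    define b' where "b' = min b T"
    have b': "t < b'" "b' \<le> T" "b' \<le> b" using b(1) t by (auto simp: b'_def)
    \<comment> \<open>With mesh below half of \<open>b' - t\<close>, the first grid point after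
      \<open>t\<close> falls where the path still has the value \<open>X t w\<close>.\<close>
    obtain m where m: "(1 / 2) ^ m < (b' - t) / (2 * T)"
      using real_arch_pow_inv[of "(b' - t) / (2 * T)" "1 / 2"] b' T by (auto simp del: power_divide)
    define a where "a = t / T * 2 ^ m"
    \<comment> \<open>The \<open>+ 1\<close> makes the grid point strictly later than
      \<open>t\<close> even if \<open>t\<close> is on the grid, since \<open>b\<close> only controls
      times after \<open>t\<close>.\<close>
    define i where "i = nat \<lfloor>a\<rfloor> + 1"
    have "a \<ge> 0" using t(1) T by (simp add: a_def)
    then have "real i = of_int \<lfloor>a\<rfloor> + 1" by (simp add: i_def)
    then have i: "t / T * 2 ^ m < real i" "real i \<le> t / T * 2 ^ m + 1"
      unfolding a_def[symmetric] by linarith+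
    have "s m i > t" using i(1) T by (simp add: s_def field_simps)
    have "s m i \<le> T * (t / T * 2 ^ m + 1) / 2 ^ m"
      unfolding s_def using i(2) T by (intro divide_right_mono mult_left_mono) auto
    also have "\<dots> = t + T * (1 / 2) ^ m" using T by (simp add: field_simps power_divide)
    also have "\<dots> < b'"
    proof -
      have "T * (1 / 2) ^ m < T * ((b' - t) / (2 * T))" using m T by (intro mult_strict_left_mono)
      also have "\<dots> = (b' - t) / 2" using T by simp
      finally show ?thesis using b' by simp
    qed
    finally have "s m i < b'" .
    then have "X (s m i) w \<in> U \<inter> S"
      using b(2)[of "s m i"] b' \<open>s m i > t\<close> X_in[OF s wM] by simp
    then have "X (s m i) w = X t w" using U by simp
    moreover have "i \<le> 2 ^ m"
    proof -
      have "T * real i / 2 ^ m < T" using \<open>s m i < b'\<close> b'(2) by (simp add: s_def)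
      then show ?thesis using T by (simp add: field_simps)
    qed
    ultimately show ?thesis using wE[of m] wM unfolding E_iff by metis
  qed
  ultimately show ?thesis using ev by (intro bexI[of _ "\<Union>m. E m"]) auto
qed

end

section \<open>Drifts in the storage network\<close>

text \<open>Workloads, copies and excess are all of this form, so one jump computation and one
  comparison of weights serve them all.\<close>

definition weighted_count :: "nat \<Rightarrow> (nat \<Rightarrow> nat) \<Rightarrow> (nat \<Rightarrow> nat) \<Rightarrow> nat" where
  "weighted_count d v x = (\<Sum>i\<le>d. v i * x i)"

text \<open>Additive on both sides because the values are natural numbers and a jump may lower
  them.\<close>

lemma weighted_count_move:
  assumes "a \<noteq> b" "a \<le> d" "b \<le> d" "x a > 0"
  shows "weighted_count d v (move a b x) + v a = weighted_count d v x + v b"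
proof -
  have split: "(\<Sum>i\<le>d. g i) = g a + g b + (\<Sum>i\<in>{..d} - {a} - {b}. g i)" for g :: "nat \<Rightarrow> nat"
    using assms by (simp add: sum.remove[of _ a] sum.remove[of _ b] add.assoc)
  have "(\<Sum>i\<in>{..d} - {a} - {b}. v i * move a b x i) = (\<Sum>i\<in>{..d} - {a} - {b}. v i * x i)"
    by (intro sum.cong) (auto simp: move_def)
  moreover have "v a * (x a - 1) + v a = v a * x a" using assms(4)
    by (cases "x a") auto
  ultimately show ?thesis
    using assms(1) unfolding weighted_count_def split by (simp add: move_def)
qed

lemma weighted_count_mono:
  "(\<And>i. i \<le> d \<Longrightarrow> v i * x i \<le> v' i * x i) \<Longrightarrow> weighted_count d v x \<le> weighted_count d v' x"
  unfolding weighted_count_def by (intro sum_mono) auto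

lemma weighted_count_add:
  "weighted_count d (\<lambda>i. v i + v' i) x = weighted_count d v x + weighted_count d v' x"
  by (simp add: weighted_count_def sum.distrib algebra_simps)

lemma weighted_count_mult:
  "weighted_count d (\<lambda>i. c * v i) x = c * weighted_count d v x"
  by (simp add: weighted_count_def sum_distrib_left algebra_simps)

lemma weighted_count_single:
  "j \<le> d \<Longrightarrow> weighted_count d (\<lambda>i. of_bool (i = j)) x = x j"
  by (simp add: weighted_count_def of_bool_def if_distrib[of "\<lambda>a. a * _"] cong: if_cong)

lemma network_states_iff:
  "x \<in> network_states d F \<longleftrightarrow> (\<forall>i>d. x i = 0) \<and> weighted_count d (\<lambda>_. 1) x = F"
  by (simp add: network_states_def weighted_count_def)

lemma move_in_network_states:
  assumes "x \<in> network_states d F" "a \<noteq> b" "a \<le> d" "b \<le> d" "x a > 0"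
  shows "move a b x \<in> network_states d F"
proof -
  have "weighted_count d (\<lambda>_. 1) (move a b x) = F"
    using weighted_count_move[of a b d x "\<lambda>_. 1"] assms by (simp add: network_states_iff)
  moreover have "\<forall>i>d. move a b x i = 0"
    using assms by (simp add: move_def network_states_iff)
  ultimately show ?thesis by (simp add: network_states_iff)
qed

lemma network_rate_nonneg: "lam \<ge> 0 \<Longrightarrow> mu \<ge> 0 \<Longrightarrow> network_rate lam mu d N x y \<ge> 0"
  unfolding network_rate_def by (intro add_nonneg_nonneg sum_nonneg) auto

text \<open>The generator applied to \<open>f\<close>, summed over transitions instead of target
  states.\<close>

definition network_drift ::
  "real \<Rightarrow> real \<Rightarrow> nat \<Rightarrow> nat \<Rightarrow> ((nat \<Rightarrow> nat) \<Rightarrow> real) \<Rightarrow> (nat \<Rightarrow> nat) \<Rightarrow> real" where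
  "network_drift lam mu d N f x =
     (\<Sum>k = 1..d. mu * real k * real (x k) * (f (move k (k - 1) x) - f x)) +
     (\<Sum>k = 1..d - 1. if x k > 0 \<and> (\<forall>i\<in>{1..<k}. x i = 0)
        then lam * real N * (f (move k (k + 1) x) - f x) else 0)"

lemma network_rate_sum:
  assumes "finite (network_states d F)" "x \<in> network_states d F"
  shows "(\<Sum>y\<in>network_states d F. network_rate lam mu d N x y * (f y - f x))
    = network_drift lam mu d N f x"
proof -
  let ?S = "network_states d F"
  have loss: "(\<Sum>y\<in>?S. (if y = move k (k - 1) x then mu * real k * real (x k) else 0) * (f y - f x))
      = mu * real k * real (x k) * (f (move k (k - 1) x) - f x)" if "k \<in> {1..d}" for k
  \<comment> \<open>On an empty level the truncated \<open>move\<close> may leave the state space,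
    but its rate is zero; otherwise the target is one of the states summed over.\<close>
  proof (cases "x k = 0")
    case False
    then have "move k (k - 1) x \<in> ?S"
      using that assms(2) by (intro move_in_network_states) auto
    then show ?thesis
      using assms(1) by (simp add: if_distrib[of "\<lambda>a. a * _"] cong: if_cong)
  qed (auto intro!: sum.neutral)
  have dup: "(\<Sum>y\<in>?S. (if y = move k (k + 1) x \<and> x k > 0 \<and> (\<forall>i\<in>{1..<k}. x i = 0)
        then lam * real N else 0) * (f y - f x))
      = (if x k > 0 \<and> (\<forall>i\<in>{1..<k}. x i = 0)
        then lam * real N * (f (move k (k + 1) x) - f x) else 0)" if "k \<in> {1..d - 1}" for k
  proof (cases "x k > 0 \<and> (\<forall>i\<in>{1..<k}. x i = 0)")
    case True
    then have "move k (k + 1) x \<in> ?S"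
      using that assms(2) by (intro move_in_network_states) auto
    then show ?thesis
      using assms(1) True by (simp add: if_distrib[of "\<lambda>a. a * _"] cong: if_cong)
  next
    case False
    then show ?thesis by (simp only: if_False simp_thms) simp
  qed
  have "(\<Sum>y\<in>?S. network_rate lam mu d N x y * (f y - f x))
    = (\<Sum>k = 1..d. \<Sum>y\<in>?S. (if y = move k (k - 1) x then mu * real k * real (x k) else 0) * (f y - f x))
    + (\<Sum>k = 1..d - 1. \<Sum>y\<in>?S. (if y = move k (k + 1) x \<and> x k > 0 \<and> (\<forall>i\<in>{1..<k}. x i = 0)
        then lam * real N else 0) * (f y - f x))"
    unfolding network_rate_def distrib_right sum.distrib sum_distrib_right
    by (intro arg_cong2[where f="(+)"] sum.swap)
  also have "\<dots> = network_drift lam mu d N f x"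
    unfolding network_drift_def by (intro arg_cong2[where f="(+)"] sum.cong refl loss dup)
  finally show ?thesis .
qed

lemma network_drift_add:
  "network_drift lam mu d N (\<lambda>x. f x + g x) x = network_drift lam mu d N f x + network_drift lam mu d N g x"
proof -
  have "(if P then c * (f y + g y - (f x + g x)) else 0)
      = (if P then c * (f y - f x) else 0) + (if P then c * (g y - g x) else 0)" for P c y
    by (simp add: algebra_simps)
  moreover have "c * (f y + g y - (f x + g x)) = c * (f y - f x) + c * (g y - g x)" for c y
    by (simp add: algebra_simps)
  ultimately show ?thesis unfolding network_drift_def by (simp only: sum.distrib)
qed

lemma network_drift_mult:
  "network_drift lam mu d N (\<lambda>x. c * f x) x = c * network_drift lam mu d N f x"
proof -
  have "(if P then a * (c * f y - c * f x) else 0) = c * (if P then a * (f y - f x) else 0)" for P a y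
    by (simp add: algebra_simps)
  moreover have "a * (c * f y - c * f x) = c * (a * (f y - f x))" for a y
    by (simp add: algebra_simps)
  ultimately show ?thesis
    unfolding network_drift_def by (simp only: sum_distrib_left[symmetric] distrib_left)
qed

lemma network_drift_const: "network_drift lam mu d N (\<lambda>x. c) x = 0"
  unfolding network_drift_def by (simp cong: if_cong)

lemma network_drift_sum:
  "finite A \<Longrightarrow> network_drift lam mu d N (\<lambda>x. \<Sum>a\<in>A. f a x) x = (\<Sum>a\<in>A. network_drift lam mu d N (f a) x)"
  by (induction A rule: finite_induct) (simp_all add: network_drift_const network_drift_add)

section \<open>Workloads, power sums and their drifts in busy states\<close>

text \<open>
  A duplication at level at most \<open>k\<close> lowers the workload of the levels \<open>1, \<dots>, k\<close> by one, whatever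
  that level is; losses raise it by at most one. Truncated subtraction gives weight \<open>0\<close> to the
  levels above \<open>k\<close>.
\<close>

definition workload :: "nat \<Rightarrow> nat \<Rightarrow> (nat \<Rightarrow> nat) \<Rightarrow> nat" where
  "workload d k = weighted_count d (\<lambda>i. if i = 0 then 0 else k + 1 - i)"

definition copies :: "nat \<Rightarrow> (nat \<Rightarrow> nat) \<Rightarrow> nat" where
  "copies d = weighted_count d (\<lambda>i. i)"

text \<open>Counts the files with more than \<open>p + 1\<close> copies. Being an integer, it is
  zero as soon as it is below 1.\<close>

definition excess :: "nat \<Rightarrow> nat \<Rightarrow> (nat \<Rightarrow> nat) \<Rightarrow> nat" where
  "excess d p = weighted_count d (\<lambda>i. of_bool (p + 2 \<le> i))"

lemma excess_zeroD: "excess d p x = 0 \<Longrightarrow> p + 2 \<le> i \<Longrightarrow> i \<le> d \<Longrightarrow> x i = 0"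
  by (auto simp: excess_def weighted_count_def)

text \<open>Discrete substitute for \<open>w ^ (m + 1) / (m + 1)\<close> whose unit increments are
  exact \<open>m\<close>-th powers.\<close>

definition power_sum :: "nat \<Rightarrow> nat \<Rightarrow> real" where
  "power_sum m w = (\<Sum>i\<le>w. real i ^ m)"

lemma power_sum_Suc: "power_sum m (Suc w) = power_sum m w + (real w + 1) ^ m"
  by (simp add: power_sum_def add.commute)

lemma power_sum_mono: "w \<le> w' \<Longrightarrow> power_sum m w \<le> power_sum m w'"
  unfolding power_sum_def by (intro sum_mono2) auto

lemma power_sum_nonneg: "power_sum m w \<ge> 0"
  unfolding power_sum_def by (intro sum_nonneg) auto

lemma power_sum_0: "m \<ge> 1 \<Longrightarrow> power_sum m 0 = 0"
  by (simp add: power_sum_def)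

text \<open>The upper half of the range has at least \<open>w / 2\<close> terms, each at least
  \<open>(w / 2) ^ m\<close>.\<close>

lemma power_sum_ge: "power_sum m w \<ge> (real w / 2) ^ Suc m"
proof -
  have "(real w / 2) ^ Suc m = real w / 2 * (real w / 2) ^ m" by simp
  also have "\<dots> \<le> real (card {w - w div 2..w}) * (real w / 2) ^ m"
    by (intro mult_right_mono) auto
  also have "\<dots> \<le> (\<Sum>i\<in>{w - w div 2..w}. real i ^ m)"
    unfolding of_nat_mult[symmetric] sum_constant[symmetric]
    by (intro sum_mono power_mono) auto
  also have "\<dots> \<le> power_sum m w" unfolding power_sum_def by (intro sum_mono2) auto
  finally show ?thesis .
qed

text \<open>The lowest occupied level \<open>k\<close> is at most \<open>p < d\<close>, so
  duplication runs at full rate \<open>lam * N\<close> and moves a file to a level at most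
  \<open>p + 1\<close>.\<close>

locale busy_state =
  fixes lam mu :: real and d p N k :: nat and x :: "nat \<Rightarrow> nat"
  assumes lam: "lam \<ge> 0" and mu: "mu \<ge> 0"
    and p: "p < d" and k: "1 \<le> k" "k \<le> p" "x k > 0"
    and lowest: "\<And>i. 1 \<le> i \<Longrightarrow> i < k \<Longrightarrow> x i = 0"
    and no_excess: "excess d p x = 0"
begin

abbreviation "drift \<equiv> network_drift lam mu d N"

lemma drift_eq:
  "drift f x = (\<Sum>j = 1..d. mu * real j * real (x j) * (f (move j (j - 1) x) - f x))
    + lam * real N * (f (move k (k + 1) x) - f x)"
proof -
  have "(x j > 0 \<and> (\<forall>i\<in>{1..<j}. x i = 0)) = (j = k)" if "j \<in> {1..d - 1}" for j
  proof
    assume "x j > 0 \<and> (\<forall>i\<in>{1..<j}. x i = 0)"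
    then show "j = k" using k lowest[of j] that by (cases j k rule: linorder_cases) auto
  qed (use k lowest in auto)
  then have "(\<Sum>j = 1..d - 1. if x j > 0 \<and> (\<forall>i\<in>{1..<j}. x i = 0)
        then lam * real N * (f (move j (j + 1) x) - f x) else 0)
      = (\<Sum>j = 1..d - 1. if j = k then lam * real N * (f (move j (j + 1) x) - f x) else 0)"
    by (intro sum.cong if_cong refl) simp_all
  also have "\<dots> = lam * real N * (f (move k (k + 1) x) - f x)" using k p by (simp, linarith)
  finally show ?thesis unfolding network_drift_def by simp
qed

text \<open>The loss rates \<open>mu * j * x j\<close> add up to \<open>mu\<close> times the number
  of copies however these are distributed, so the copies form an M/M/infinity queue.\<close>

lemma drift_copies:
  "drift (\<lambda>x. g (copies d x)) x =
    mu * real (copies d x) * (g (copies d x - 1) - g (copies d x))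
    + lam * real N * (g (copies d x + 1) - g (copies d x))"
proof -
  let ?L = "copies d x"
  have "mu * real j * real (x j) * (g (copies d (move j (j - 1) x)) - g ?L)
      = mu * real (j * x j) * (g (?L - 1) - g ?L)" if "j \<in> {1..d}" for j
  proof (cases "x j = 0")
    case False
    then have "copies d (move j (j - 1) x) = ?L - 1"
      using weighted_count_move[of j "j - 1" d x "\<lambda>i. i"] that by (cases j) (simp_all add: copies_def)
    then show ?thesis by simp
  qed simp
  then have "(\<Sum>j = 1..d. mu * real j * real (x j) * (g (copies d (move j (j - 1) x)) - g ?L))
      = (\<Sum>j = 1..d. mu * real (j * x j) * (g (?L - 1) - g ?L))"
    by (rule sum.cong[OF refl])
  also have "\<dots> = mu * (\<Sum>j = 1..d. real (j * x j)) * (g (?L - 1) - g ?L)"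
    by (simp only: sum_distrib_left sum_distrib_right)
  also have "(\<Sum>j = 1..d. real (j * x j)) = real ?L"
    unfolding copies_def weighted_count_def of_nat_sum
    by (intro sum.mono_neutral_left) auto
  finally have "(\<Sum>j = 1..d. mu * real j * real (x j) * (g (copies d (move j (j - 1) x)) - g ?L))
    = mu * real ?L * (g (?L - 1) - g ?L)" .
  moreover have "copies d (move k (k + 1) x) = ?L + 1"
    using weighted_count_move[of k "k + 1" d x "\<lambda>i. i"] k p by (simp add: copies_def)
  ultimately show ?thesis unfolding drift_eq by simp
qed

text \<open>A loss from a level in \<open>{2..l + 1}\<close> raises the workload by exactly one, a
  loss from level 1 does not raise it, and higher levels have weight 0 before and after. A
  duplication at a level up to \<open>l\<close> lowers it by one.\<close>

lemma drift_workload: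
  assumes m: "m \<ge> 1" and l: "l < d"
  shows "drift (\<lambda>x. power_sum m (workload d l x)) x
    \<le> mu * real (\<Sum>j = 2..l + 1. j * x j) * (real (workload d l x) + 1) ^ m
      - lam * real N * real (workload d l x) ^ m"
proof -
  let ?v = "\<lambda>i. if i = 0 then 0 else l + 1 - i" and ?W = "workload d l x"
  let ?\<phi> = "power_sum m"
  have loss: "mu * real j * real (x j) * (?\<phi> (workload d l (move j (j - 1) x)) - ?\<phi> ?W)
      \<le> mu * (if j \<in> {2..l + 1} then real (j * x j) else 0) * (real ?W + 1) ^ m"
    if "j \<in> {1..d}" for j
  proof (cases "x j = 0")
    case False
    have W: "workload d l (move j (j - 1) x) + ?v j = ?W + ?v (j - 1)"
      unfolding workload_def using False that by (intro weighted_count_move) auto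
    show ?thesis
    proof (cases "j \<in> {2..l + 1}")
      case True
      then have "workload d l (move j (j - 1) x) = Suc ?W" using W by auto
      then show ?thesis using True by (simp add: power_sum_Suc)
    next
      case f: False
      then have "workload d l (move j (j - 1) x) \<le> ?W" using W that by (auto split: if_splits)
      from power_sum_mono[OF this] show ?thesis
        using f mu by (auto intro!: mult_nonneg_nonpos)
    qed
  qed simp
  have "(\<Sum>j = 1..d. mu * real j * real (x j) * (?\<phi> (workload d l (move j (j - 1) x)) - ?\<phi> ?W))
      \<le> (\<Sum>j = 1..d. mu * (if j \<in> {2..l + 1} then real (j * x j) else 0) * (real ?W + 1) ^ m)"
    by (intro sum_mono loss)
  also have "\<dots> = mu * (\<Sum>j = 1..d. if j \<in> {2..l + 1} then real (j * x j) else 0) * (real ?W + 1) ^ m"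
    by (simp only: sum_distrib_left sum_distrib_right)
  also have "(\<Sum>j = 1..d. if j \<in> {2..l + 1} then real (j * x j) else 0) = (\<Sum>j = 2..l + 1. real (j * x j))"
    using l by (subst sum.inter_restrict[symmetric]) (auto intro!: sum.cong)
  finally have 1: "(\<Sum>j = 1..d. mu * real j * real (x j) * (?\<phi> (workload d l (move j (j - 1) x)) - ?\<phi> ?W))
      \<le> mu * real (\<Sum>j = 2..l + 1. j * x j) * (real ?W + 1) ^ m"
    by (simp only: of_nat_sum)
  have W: "workload d l (move k (k + 1) x) + ?v k = ?W + ?v (k + 1)"
    unfolding workload_def using k p by (intro weighted_count_move) auto
  have "?\<phi> (workload d l (move k (k + 1) x)) - ?\<phi> ?W \<le> - (real ?W ^ m)"
  proof (cases "k \<le> l")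
    case True
    then have "?W = Suc (workload d l (move k (k + 1) x))" using W k by simp
    then show ?thesis by (simp add: power_sum_Suc add.commute)
  next
    \<comment> \<open>All levels up to \<open>l\<close> are empty, so the workload is 0, and
      \<open>0 ^ m\<close> vanishes because \<open>m\<close> is at least 1.\<close>
    case False
    have "?v i * x i = 0" for i
      using False lowest[of i] by (cases "1 \<le> i \<and> i < k") auto
    then have "?W = 0" unfolding workload_def weighted_count_def by (simp only: sum.neutral_const)
    moreover have "workload d l (move k (k + 1) x) = ?W" using W False by simp
    ultimately show ?thesis using m by (simp add: power_0_left)
  qed
  then have "lam * real N * (?\<phi> (workload d l (move k (k + 1) x)) - ?\<phi> ?W)
      \<le> lam * real N * (- (real ?W ^ m))"
    using lam by (intro mult_left_mono) auto
  with 1 show ?thesis unfolding drift_eq by simp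
qed

lemma drift_lost: "drift (\<lambda>x. real (x 0)) x = mu * real (x 1)"
proof -
  have "(\<Sum>j = 1..d. mu * real j * real (x j) * (real (move j (j - 1) x 0) - real (x 0)))
    = (\<Sum>j = 1..d. if j = 1 then mu * real (x 1) else 0)"
    by (intro sum.cong) (auto simp: move_def)
  then show ?thesis unfolding drift_eq using k p by (simp add: move_def)
qed

text \<open>From zero excess, level \<open>p + 2\<close> could be reached only by a duplication at
  level \<open>p + 1\<close>, but the duplication takes place at \<open>k \<le> p\<close>.\<close>

lemma drift_excess: "drift (\<lambda>x. real (excess d p x)) x = 0"
proof -
  have "mu * real j * real (x j) * (real (excess d p (move j (j - 1) x)) - real (excess d p x)) = 0"
    if "j \<in> {1..d}" for j
  proof (cases "x j = 0")
    case False
    then have "j < p + 2" using excess_zeroD[OF no_excess, of j] that by force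
    then show ?thesis
      using weighted_count_move[of j "j - 1" d x "\<lambda>i. of_bool (p + 2 \<le> i)"] that False
      by (cases j) (simp_all add: excess_def)
  qed simp
  moreover have "excess d p (move k (k + 1) x) = excess d p x"
    using weighted_count_move[of k "k + 1" d x "\<lambda>i. of_bool (p + 2 \<le> i)"] k p
    by (simp add: excess_def)
  ultimately show ?thesis unfolding drift_eq by (simp only: sum.neutral_const cong: sum.cong) simp
qed

end

section \<open>Balance identities and comparisons between linear functionals\<close>

lemma weighted_count_cong:
  "(\<And>i. i \<le> d \<Longrightarrow> x i > 0 \<Longrightarrow> v i = v' i) \<Longrightarrow> weighted_count d v x = weighted_count d v' x"
  unfolding weighted_count_def by (intro sum.cong) auto

lemma weighted_count_le:
  "(\<And>i. i \<le> d \<Longrightarrow> x i > 0 \<Longrightarrow> v i \<le> v' i) \<Longrightarrow> weighted_count d v x \<le> weighted_count d v' x"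
  by (rule weighted_count_mono) (metis gr0I mult_0_right mult_le_mono1 order_refl)

text \<open>The weights agree on every occupied level: both sides give \<open>p\<close> up to level
  \<open>p\<close> and \<open>p + 1\<close> at level \<open>p + 1\<close>.\<close>

lemma balance_upper:
  assumes "x \<in> network_states d F" "1 \<le> p" "p < d" "excess d p x = 0"
  shows "x (p + 1) + p * F = copies d x + p * x 0 + workload d (p - 1) x"
proof -
  have le: "i \<le> p + 1" if "i \<le> d" "x i > 0" for i
    using excess_zeroD[OF assms(4), of i] that by (cases "i \<le> p + 1") auto
  have "x (p + 1) + p * F = weighted_count d (\<lambda>i. of_bool (i = p + 1) + p * 1) x"
    unfolding weighted_count_add weighted_count_mult
    using assms by (simp add: weighted_count_single network_states_iff)
  also have "\<dots> = weighted_count d (\<lambda>i. i + p * of_bool (i = 0) + (if i = 0 then 0 else p - 1 + 1 - i)) x"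
    using assms(2) le by (intro weighted_count_cong) (force simp: of_bool_def)
  also have "\<dots> = copies d x + p * x 0 + workload d (p - 1) x"
    unfolding weighted_count_add weighted_count_mult workload_def[symmetric]
    by (simp add: weighted_count_single copies_def)
  finally show ?thesis .
qed

text \<open>On levels \<open>1\<close> to \<open>p + 1\<close> workload weight and copies add up to
  \<open>p + 1\<close>; the last summand compensates level 0. This locates \<open>x p\<close>, which
  \<open>workload d p\<close> approximates.\<close>

lemma balance_lower:
  assumes "x \<in> network_states d F" "p < d" "excess d p x = 0"
  shows "workload d p x + copies d x + (p + 1) * x 0 = (p + 1) * F"
proof -
  have le: "i \<le> p + 1" if "i \<le> d" "x i > 0" for i
    using excess_zeroD[OF assms(3), of i] that by (cases "i \<le> p + 1") auto
  have "workload d p x + copies d x + (p + 1) * x 0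
      = weighted_count d (\<lambda>i. (if i = 0 then 0 else p + 1 - i) + i + (p + 1) * of_bool (i = 0)) x"
    unfolding weighted_count_add weighted_count_mult
    by (simp add: weighted_count_single copies_def workload_def)
  also have "\<dots> = weighted_count d (\<lambda>i. (p + 1) * 1) x"
    using le by (intro weighted_count_cong) (force simp: of_bool_def)
  also have "\<dots> = (p + 1) * F"
    unfolding weighted_count_mult using assms by (simp add: network_states_iff)
  finally show ?thesis .
qed

lemma workload_ge:
  assumes "1 \<le> p" "p \<le> d" shows "x p \<le> workload d p x"
proof -
  have "weighted_count d (\<lambda>i. of_bool (i = p)) x \<le> workload d p x"
    unfolding workload_def using assms by (intro weighted_count_le) (auto simp: of_bool_def)
  then show ?thesis using assms by (simp add: weighted_count_single)
qed

text \<open>Below level \<open>p\<close>, \<open>p + 1 - i\<close> is at most twice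
  \<open>p - i\<close>. With \<open>workload_ge\<close> this encloses \<open>x p\<close> up to the
  workload of order \<open>p - 1\<close>.\<close>

lemma workload_le:
  assumes "1 \<le> p" "p \<le> d"
  shows "workload d p x \<le> x p + 2 * workload d (p - 1) x"
proof -
  have "workload d p x \<le> weighted_count d (\<lambda>i. of_bool (i = p) + 2 * (if i = 0 then 0 else p - 1 + 1 - i)) x"
    unfolding workload_def by (intro weighted_count_le) (auto simp: of_bool_def)
  also have "\<dots> = x p + 2 * workload d (p - 1) x"
    unfolding weighted_count_add weighted_count_mult workload_def[symmetric] using assms
    by (simp add: weighted_count_single)
  finally show ?thesis .
qed

lemma workload_mono: "k \<le> l \<Longrightarrow> workload d k x \<le> workload d l x"
  unfolding workload_def by (intro weighted_count_le) auto

lemma sum_eq_weighted_count: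
  "l \<le> d \<Longrightarrow> (\<Sum>j = 2..l. j * x j) = weighted_count d (\<lambda>i. if i \<in> {2..l} then i else 0) x"
proof -
  assume "l \<le> d"
  then have "{..d} \<inter> {2..l} = {2..l}" by auto
  moreover have "(\<Sum>i\<le>d. (if i \<in> {2..l} then i else 0) * x i) = (\<Sum>i\<le>d. if i \<in> {2..l} then i * x i else 0)"
    by (intro sum.cong) auto
  ultimately show ?thesis
    unfolding weighted_count_def by (simp only: sum.inter_restrict[symmetric] finite_atMost)
qed

text \<open>Every occupied level counted on the left has workload weight at least 1. The losses
  raising the workload of order \<open>l - 1\<close> are thus controlled by that of order
  \<open>l\<close>.\<close>

lemma loss_sum_le_workload:
  assumes "l \<le> d" shows "(\<Sum>j = 2..l. j * x j) \<le> l * workload d l x"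
proof -
  have "i \<le> l * (l + 1 - i)" if "2 \<le> i" "i \<le> l" for i
  proof -
    have "l * 1 \<le> l * (l + 1 - i)" using that by (intro mult_le_mono2) auto
    with that(2) show ?thesis by linarith
  qed
  then show ?thesis
    unfolding sum_eq_weighted_count[OF assms] workload_def weighted_count_mult[symmetric]
    by (intro weighted_count_le) auto
qed

text \<open>The term for level \<open>p + 1\<close> is kept because subtracting it makes the
  workload of order \<open>p - 1\<close> subcritical.\<close>

lemma loss_sum_le_copies:
  assumes "p < d" shows "(\<Sum>j = 2..p. j * x j) + (p + 1) * x (p + 1) \<le> copies d x"
proof -
  have "(\<Sum>j = 2..p. j * x j) + (p + 1) * x (p + 1) = weighted_count d
      (\<lambda>i. (if i \<in> {2..p} then i else 0) + (p + 1) * of_bool (i = p + 1)) x"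
    unfolding weighted_count_add weighted_count_mult
    using assms sum_eq_weighted_count[of p d x] weighted_count_single[of "p + 1" d x] by simp
  also have "\<dots> \<le> copies d x"
    unfolding copies_def by (intro weighted_count_le) auto
  finally show ?thesis .
qed

text \<open>\<open>\<kappa>\<close> is the load of a queue. For large \<open>w\<close>,
  \<open>(1 + 1 / w) ^ m\<close> is close to 1, and the gap \<open>1 - \<kappa>\<close>, magnified
  by \<open>B\<close>, beats the extra \<open>w ^ m\<close>.\<close>

lemma queue_constants:
  fixes \<kappa> :: real
  assumes "0 \<le> \<kappa>" "\<kappa> < 1"
  shows "\<exists>B>0. \<exists>A\<ge>0. \<forall>w::nat. real w ^ m - B * real w ^ m + B * \<kappa> * (real w + 1) ^ m \<le> A"
proof -
  \<comment> \<open>Half of the magnified gap, \<open>B * (1 - \<kappa>) / 2 = 1\<close>, pays for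
    \<open>w ^ m\<close>; the other half absorbs the ratio of \<open>(w + 1) ^ m\<close> to
    \<open>w ^ m\<close>.\<close>
  define B where "B = 2 / (1 - \<kappa>)"
  have B: "B > 0" "B * (1 - \<kappa>) = 2" using assms by (auto simp: B_def divide_simps)
  define g where "g = (\<lambda>w::nat. real w ^ m - B * real w ^ m + B * \<kappa> * (real w + 1) ^ m)"
  have "(\<lambda>w. \<kappa> * (1 + inverse (real w)) ^ m) \<longlonglongrightarrow> \<kappa> * (1 + 0) ^ m"
    by (intro tendsto_intros lim_inverse_n)
  moreover have "\<kappa> * (1 + 0) ^ m < (1 + \<kappa>) / 2" using assms by simp
  ultimately have "\<forall>\<^sub>F w in sequentially. \<kappa> * (1 + inverse (real w)) ^ m < (1 + \<kappa>) / 2"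
    by (rule order_tendstoD)
  then have "\<forall>\<^sub>F w in sequentially. g w \<le> 0"
    using eventually_gt_at_top[of 0]
  proof eventually_elim
    case (elim w)
    have "\<kappa> * (real w + 1) ^ m = \<kappa> * (1 + inverse (real w)) ^ m * real w ^ m"
      using elim(2) by (simp add: power_mult_distrib[symmetric] mult.assoc field_simps)
    also have "\<dots> \<le> (1 + \<kappa>) / 2 * real w ^ m"
      using elim(1) by (intro mult_right_mono) auto
    finally have "B * (\<kappa> * (real w + 1) ^ m) \<le> B * ((1 + \<kappa>) / 2 * real w ^ m)"
      using B by (intro mult_left_mono) auto
    also have "\<dots> = (B - B * (1 - \<kappa>) / 2) * real w ^ m" by (simp add: field_simps)
    also have "\<dots> = B * real w ^ m - real w ^ m" unfolding B by (simp add: algebra_simps)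
    finally show ?case by (simp add: g_def)
  qed
  then obtain w0 where w0: "\<And>w. w \<ge> w0 \<Longrightarrow> g w \<le> 0"
    by (auto simp: eventually_sequentially)
  \<comment> \<open>The finitely many exceptional \<open>w < w0\<close> determine the additive
    constant.\<close>
  have "g w \<le> (\<Sum>w<w0. \<bar>g w\<bar>)" for w
  proof (cases "w < w0")
    case True
    then have "\<bar>g w\<bar> \<le> (\<Sum>w<w0. \<bar>g w\<bar>)" by (intro member_le_sum) auto
    then show ?thesis by simp
  next
    case False
    then have "g w \<le> 0" using w0 by simp
    also have "0 \<le> (\<Sum>w<w0. \<bar>g w\<bar>)" by (intro sum_nonneg) auto
    finally show ?thesis .
  qed
  then show ?thesis
    using B(1) by (intro exI[of _ B] conjI exI[of _ "\<Sum>w<w0. \<bar>g w\<bar>"] sum_nonneg) (auto simp: g_def)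
qed

section \<open>Exponential functionals of the number of copies\<close>

context busy_state
begin

text \<open>Above \<open>(\<rho> + \<epsilon> / 2) * N\<close> the drift is nonpositive; below, the
  functional is at most \<open>exp (- (\<theta> * \<epsilon> * N / 2))\<close> and only its upward
  jumps are counted.\<close>

lemma drift_exp_upper:
  assumes \<rho>: "lam = \<rho> * mu" "\<rho> \<ge> 0" and \<theta>: "\<theta> > 0" "\<rho> * (exp \<theta> - 1) \<le> \<epsilon> / 2"
  shows "drift (\<lambda>x. exp (\<theta> * (real (copies d x) - (\<rho> + \<epsilon>) * real N))) x
    \<le> lam * real N * exp \<theta> * exp (- (\<theta> * \<epsilon> * real N / 2))"
proof -
  let ?L = "copies d x"
  define E where "E = exp (\<theta> * (real ?L - (\<rho> + \<epsilon>) * real N))"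
  have up: "exp (\<theta> * (real (?L + 1) - (\<rho> + \<epsilon>) * real N)) = E * exp \<theta>"
    by (simp add: E_def exp_add[symmetric] algebra_simps)
  \<comment> \<open>The truncated \<open>?L - 1\<close> at \<open>?L = 0\<close> is harmless because
    of the factor \<open>?L\<close>.\<close>
  have down: "mu * real ?L * (exp (\<theta> * (real (?L - 1) - (\<rho> + \<epsilon>) * real N)) - E)
      = mu * real ?L * (E / exp \<theta> - E)"
    by (cases ?L) (simp_all add: E_def exp_diff[symmetric] algebra_simps)
  have eq: "drift (\<lambda>x. exp (\<theta> * (real (copies d x) - (\<rho> + \<epsilon>) * real N))) x
      = E * (mu * (exp \<theta> - 1) / exp \<theta>) * (\<rho> * real N * exp \<theta> - real ?L)"
    unfolding drift_copies[of "\<lambda>L. exp (\<theta> * (real L - (\<rho> + \<epsilon>) * real N))"] E_def[symmetric] up down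
    by (simp add: \<rho>(1) field_simps)
  have a: "exp \<theta> > 1" using \<theta> by simp
  show ?thesis
  proof (cases "real ?L \<ge> (\<rho> + \<epsilon> / 2) * real N")
    case True
    \<comment> \<open>The condition on \<open>\<theta>\<close> says that the tilted rate
      \<open>\<rho> * exp \<theta>\<close> is at most
      \<open>\<rho> + \<epsilon> / 2\<close>.\<close>
    have "\<rho> * exp \<theta> * real N \<le> (\<rho> + \<epsilon> / 2) * real N"
      using \<theta>(2) by (intro mult_right_mono) (auto simp: algebra_simps)
    then have "\<rho> * real N * exp \<theta> - real ?L \<le> 0" using True by (simp add: mult_ac)
    then have "E * (mu * (exp \<theta> - 1) / exp \<theta>) * (\<rho> * real N * exp \<theta> - real ?L) \<le> 0"
      using a mu by (intro mult_nonneg_nonpos) (auto simp: E_def)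
    also have "\<dots> \<le> lam * real N * exp \<theta> * exp (- (\<theta> * \<epsilon> * real N / 2))"
      using lam by simp
    finally show ?thesis unfolding eq .
  next
    case False
    then have "\<theta> * (real ?L - (\<rho> + \<epsilon>) * real N) \<le> \<theta> * (- (\<epsilon> * real N / 2))"
      using \<theta> by (intro mult_left_mono) (auto simp: field_simps)
    then have E: "E \<le> exp (- (\<theta> * \<epsilon> * real N / 2))" by (simp add: E_def)
    have "(mu * (exp \<theta> - 1) / exp \<theta>) * (\<rho> * real N * exp \<theta> - real ?L)
        \<le> (mu * (exp \<theta> - 1) / exp \<theta>) * (\<rho> * real N * exp \<theta>)"
      using a mu by (intro mult_left_mono) auto
    also have "\<dots> = lam * real N * (exp \<theta> - 1)" by (simp add: \<rho>)
    also have "\<dots> \<le> lam * real N * exp \<theta>" using lam by (intro mult_left_mono) auto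
    finally have "E * ((mu * (exp \<theta> - 1) / exp \<theta>) * (\<rho> * real N * exp \<theta> - real ?L))
        \<le> E * (lam * real N * exp \<theta>)"
      by (rule mult_left_mono) (simp add: E_def)
    also have "\<dots> \<le> exp (- (\<theta> * \<epsilon> * real N / 2)) * (lam * real N * exp \<theta>)"
      using lam E by (intro mult_right_mono) auto
    finally show ?thesis unfolding eq by (simp add: mult_ac)
  qed
qed

text \<open>Mirror image in which losses drive the functional up; the upper bound on the copies
  controls their rate.\<close>

lemma drift_exp_lower:
  assumes \<rho>: "lam = \<rho> * mu" "\<rho> \<ge> 0" and \<theta>: "\<theta> > 0" "\<rho> * (exp \<theta> - 1) \<le> \<epsilon> / 2"
    and L: "real (copies d x) \<le> (\<rho> + \<epsilon>) * real N" and \<epsilon>: "\<epsilon> \<ge> 0"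
  shows "drift (\<lambda>x. exp (\<theta> * ((\<rho> - \<epsilon>) * real N - real (copies d x)))) x
    \<le> mu * (\<rho> + \<epsilon>) * real N * exp \<theta> * exp (- (\<theta> * \<epsilon> * real N / 2))"
proof -
  let ?L = "copies d x"
  define E where "E = exp (\<theta> * ((\<rho> - \<epsilon>) * real N - real ?L))"
  have up: "exp (\<theta> * ((\<rho> - \<epsilon>) * real N - real (?L + 1))) = E / exp \<theta>"
    by (simp add: E_def exp_diff[symmetric] algebra_simps)
  have down: "mu * real ?L * (exp (\<theta> * ((\<rho> - \<epsilon>) * real N - real (?L - 1))) - E)
      = mu * real ?L * (E * exp \<theta> - E)"
    by (cases ?L) (simp_all add: E_def exp_add[symmetric] algebra_simps)
  have eq: "drift (\<lambda>x. exp (\<theta> * ((\<rho> - \<epsilon>) * real N - real (copies d x)))) x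
      = E * (mu * (exp \<theta> - 1) / exp \<theta>) * (real ?L * exp \<theta> - \<rho> * real N)"
    unfolding drift_copies[of "\<lambda>L. exp (\<theta> * ((\<rho> - \<epsilon>) * real N - real L))"] E_def[symmetric] up down
    by (simp add: \<rho>(1) field_simps)
  have a: "exp \<theta> > 1" using \<theta> by simp
  show ?thesis
  proof (cases "real ?L \<le> (\<rho> - \<epsilon> / 2) * real N")
    case True
    \<comment> \<open>Combined with
      \<open>\<rho> * exp \<theta> \<le> \<rho> + \<epsilon> / 2\<close>.\<close>
    have "\<epsilon> / 2 * 1 \<le> \<epsilon> / 2 * exp \<theta>" using a \<epsilon> by (intro mult_left_mono) auto
    then have "(\<rho> - \<epsilon> / 2) * exp \<theta> \<le> \<rho>" using \<theta>(2) by (simp add: algebra_simps)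
    then have "(\<rho> - \<epsilon> / 2) * exp \<theta> * real N \<le> \<rho> * real N" by (intro mult_right_mono) auto
    moreover have "real ?L * exp \<theta> \<le> (\<rho> - \<epsilon> / 2) * real N * exp \<theta>"
      using True by (intro mult_right_mono) auto
    moreover have "(\<rho> - \<epsilon> / 2) * real N * exp \<theta> = (\<rho> - \<epsilon> / 2) * exp \<theta> * real N" by simp
    ultimately have "real ?L * exp \<theta> - \<rho> * real N \<le> 0" by linarith
    then have "E * (mu * (exp \<theta> - 1) / exp \<theta>) * (real ?L * exp \<theta> - \<rho> * real N) \<le> 0"
      using a mu by (intro mult_nonneg_nonpos) (auto simp: E_def)
    also have "\<dots> \<le> mu * (\<rho> + \<epsilon>) * real N * exp \<theta> * exp (- (\<theta> * \<epsilon> * real N / 2))"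
      using mu \<rho> \<epsilon> by simp
    finally show ?thesis unfolding eq .
  next
    case False
    then have "\<theta> * ((\<rho> - \<epsilon>) * real N - real ?L) \<le> \<theta> * (- (\<epsilon> * real N / 2))"
      using \<theta> by (intro mult_left_mono) (auto simp: field_simps)
    then have E: "E \<le> exp (- (\<theta> * \<epsilon> * real N / 2))" by (simp add: E_def)
    have "(mu * (exp \<theta> - 1) / exp \<theta>) * (real ?L * exp \<theta> - \<rho> * real N)
        \<le> (mu * (exp \<theta> - 1) / exp \<theta>) * (real ?L * exp \<theta>)"
      using a mu \<rho> by (intro mult_left_mono) auto
    also have "\<dots> = mu * (exp \<theta> - 1) * real ?L" by simp
    also have "\<dots> \<le> mu * exp \<theta> * ((\<rho> + \<epsilon>) * real N)"
      using L mu a by (intro mult_mono) auto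
    finally have "E * ((mu * (exp \<theta> - 1) / exp \<theta>) * (real ?L * exp \<theta> - \<rho> * real N))
        \<le> E * (mu * exp \<theta> * ((\<rho> + \<epsilon>) * real N))"
      by (rule mult_left_mono) (simp add: E_def)
    also have "\<dots> \<le> exp (- (\<theta> * \<epsilon> * real N / 2)) * (mu * exp \<theta> * ((\<rho> + \<epsilon>) * real N))"
      using mu \<rho> \<epsilon> E by (intro mult_right_mono) auto
    finally show ?thesis unfolding eq by (simp add: mult_ac)
  qed
qed

end

section \<open>The Lyapunov function\<close>

text \<open>\<open>\<epsilon>_lower\<close> keeps level \<open>p\<close> occupied,
  \<open>\<epsilon>_upper\<close> keeps the load of the workload of order \<open>p - 1\<close> at
  most \<open>p * \<beta> / \<rho>\<close>, and \<open>A\<close>, \<open>B\<close> come from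
  \<open>queue_constants\<close> for this load.\<close>

locale regime =
  fixes lam mu \<beta> \<rho> \<epsilon> \<theta> A B :: real and d p :: nat
  assumes lam: "lam > 0" and mu: "mu > 0" and \<rho>: "lam = \<rho> * mu"
    and p: "2 \<le> p" "p < d" and \<epsilon>: "\<epsilon> > 0"
    and \<theta>: "\<theta> > 0" "\<rho> * (exp \<theta> - 1) \<le> \<epsilon> / 2"
    and \<epsilon>_lower: "(2 * real p + 5) * \<epsilon> < (real p + 1) * \<beta> - \<rho>"
    and \<epsilon>_upper: "(real p + 2) * \<epsilon> \<le> \<rho> - real p * \<beta>"
    and B: "B > 0"
    and A: "A \<ge> 0" "\<And>w::nat. real w ^ (p - 1) - B * real w ^ (p - 1)
      + B * (real p * \<beta> / \<rho>) * (real w + 1) ^ (p - 1) \<le> A"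
begin

text \<open>\<open>mu * p\<close> bounds the losses per unit of the next workload;
  \<open>2 ^ p\<close> comes from bounding a workload plus one by twice the next workload.\<close>

definition "C = mu * real p * 2 ^ p"
definition "r = C / lam"
text \<open>A tower below \<open>\<epsilon>' * N\<close> forces \<open>x 0\<close> and the workload
  of order \<open>p - 1\<close> to be at most \<open>\<epsilon> * N\<close>.\<close>

definition "\<epsilon>' = min \<epsilon> (B * r ^ (p - 1) * (\<epsilon> / 2) ^ p)"

text \<open>
  With this \<open>r\<close>, the gain \<open>(r / N)\<^sup>l \<cdot> C W\<^sub>l\<^sub>+\<^sub>1\<^sup>l\<^sup>+\<^sup>1\<close> of the \<open>l\<close>-th summand of the tower is exactly cancelled
  by the loss \<open>\<lambda>N (r / N)\<^sup>l\<^sup>+\<^sup>1 W\<^sub>l\<^sub>+\<^sub>1\<^sup>l\<^sup>+\<^sup>1\<close> of the next one. The factor \<open>B\<close> of the last summand is taken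
  large enough that the subcritical load of \<open>W\<^sub>p\<^sub>-\<^sub>1\<close> absorbs the remaining power.
\<close>

definition tower :: "nat \<Rightarrow> (nat \<Rightarrow> nat) \<Rightarrow> real" where
  "tower N x = real (x 0)
    + (\<Sum>l = 1..<p - 1. (r / real N) ^ l * power_sum l (workload d l x))
    + B * (r / real N) ^ (p - 1) * power_sum (p - 1) (workload d (p - 1) x)"

text \<open>Normalised to the exit threshold 1 of \<open>maximal_inequality\<close>: each of the
  four nonnegative terms reaches 1 as soon as its own quantity leaves the permitted range.\<close>

definition lyapunov :: "nat \<Rightarrow> (nat \<Rightarrow> nat) \<Rightarrow> real" where
  "lyapunov N x = inverse (\<epsilon>' * real N) * tower N x
    + exp (\<theta> * (real (copies d x) - (\<rho> + \<epsilon>) * real N))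
    + exp (\<theta> * ((\<rho> - \<epsilon>) * real N - real (copies d x)))
    + real (excess d p x)"

text \<open>Of order \<open>1 / N ^ (p - 1)\<close> up to an exponentially small term, hence
  negligible over times of order \<open>N ^ (p - 2)\<close>.\<close>

definition drift_bound :: "nat \<Rightarrow> real" where
  "drift_bound N = inverse (\<epsilon>' * real N) * (C * (r / real N) ^ (p - 2) * A)
    + 2 * (mu * (\<rho> + \<epsilon>) * real N * exp \<theta> * exp (- (\<theta> * \<epsilon> * real N / 2)))"

lemma pos: "\<rho> > 0" "C > 0" "r > 0" "\<epsilon>' > 0"
proof -
  show "\<rho> > 0" using \<rho> lam mu by (simp add: zero_less_mult_iff)
  show "C > 0" using mu p by (simp add: C_def)
  then show "r > 0" using lam by (simp add: r_def)
  then show "\<epsilon>' > 0" using B \<epsilon> by (simp add: \<epsilon>'_def)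
qed

lemma tower_nonneg:
  shows "tower N x \<ge> real (x 0)"
    and "tower N x \<ge> B * (r / real N) ^ (p - 1) * power_sum (p - 1) (workload d (p - 1) x)"
proof -
  have 1: "(\<Sum>l = 1..<p - 1. (r / real N) ^ l * power_sum l (workload d l x)) \<ge> 0"
    using pos by (intro sum_nonneg mult_nonneg_nonneg power_sum_nonneg) auto
  have 2: "B * (r / real N) ^ (p - 1) * power_sum (p - 1) (workload d (p - 1) x) \<ge> 0"
    using pos B by (intro mult_nonneg_nonneg power_sum_nonneg) auto
  show "tower N x \<ge> real (x 0)"
    "tower N x \<ge> B * (r / real N) ^ (p - 1) * power_sum (p - 1) (workload d (p - 1) x)"
    using 1 2 unfolding tower_def by linarith+
qed

lemma lyapunov_nonneg: "lyapunov N x \<ge> 0"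
  unfolding lyapunov_def using pos tower_nonneg(1)[of x N]
  by (intro add_nonneg_nonneg mult_nonneg_nonneg) auto

lemma drift_bound_nonneg: "drift_bound N \<ge> 0"
  unfolding drift_bound_def using pos A(1) mu \<epsilon> by simp

lemma lyapunov_less_1:
  assumes N: "N \<ge> 1" and f: "lyapunov N x < 1"
  shows "excess d p x = 0" "real (copies d x) < (\<rho> + \<epsilon>) * real N"
    "(\<rho> - \<epsilon>) * real N < real (copies d x)" "real (x 0) < \<epsilon> * real N"
    "real (workload d (p - 1) x) \<le> \<epsilon> * real N"
proof -
  let ?t = "inverse (\<epsilon>' * real N) * tower N x"
  let ?u = "exp (\<theta> * (real (copies d x) - (\<rho> + \<epsilon>) * real N))"
  let ?l = "exp (\<theta> * ((\<rho> - \<epsilon>) * real N - real (copies d x)))"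
  have t0: "?t \<ge> 0" using pos tower_nonneg(1)[of x N] by (intro mult_nonneg_nonneg) auto
  have sum: "?t + ?u + ?l + real (excess d p x) < 1" using f by (simp add: lyapunov_def)
  have "?u > 0" "?l > 0" by simp_all
  then have "real (excess d p x) < 1" "?u < 1" "?l < 1" "?t < 1"
    using sum t0 by linarith+
  then show "excess d p x = 0" "real (copies d x) < (\<rho> + \<epsilon>) * real N"
    "(\<rho> - \<epsilon>) * real N < real (copies d x)"
    using \<theta>(1) by (auto simp: mult_less_0_iff)
  have tower: "tower N x < \<epsilon>' * real N"
    using \<open>?t < 1\<close> pos N by (simp add: field_simps)
  have "\<epsilon>' * real N \<le> \<epsilon> * real N" by (intro mult_right_mono) (auto simp: \<epsilon>'_def)
  then show "real (x 0) < \<epsilon> * real N" using tower tower_nonneg(1)[of x N] by linarith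
  show "real (workload d (p - 1) x) \<le> \<epsilon> * real N"
  proof (rule ccontr)
    let ?W = "workload d (p - 1) x"
    assume "\<not> ?thesis"
    then have "(\<epsilon> * real N / 2) ^ p \<le> (real ?W / 2) ^ Suc (p - 1)"
      using \<epsilon> p by (auto intro!: power_mono)
    also have "\<dots> \<le> power_sum (p - 1) ?W" by (rule power_sum_ge)
    finally have "B * (r / real N) ^ (p - 1) * (\<epsilon> * real N / 2) ^ p
        \<le> B * (r / real N) ^ (p - 1) * power_sum (p - 1) ?W"
      using B pos by (intro mult_left_mono) auto
    also have "\<dots> \<le> tower N x" by (rule tower_nonneg)
    also have "\<dots> < \<epsilon>' * real N" by (rule tower)
    also have "\<dots> \<le> B * r ^ (p - 1) * (\<epsilon> / 2) ^ p * real N"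
      by (intro mult_right_mono) (auto simp: \<epsilon>'_def)
    \<comment> \<open>The \<open>p - 1\<close> divisions by \<open>N\<close> leave one of the
      \<open>p\<close> factors \<open>N\<close>.\<close>
    also have "\<dots> = B * (r / real N) ^ (p - 1) * (\<epsilon> * real N / 2) ^ p"
    proof -
      have "real N ^ p = real N * real N ^ (p - 1)" using p by (cases p) auto
      then show ?thesis using N by (simp add: power_divide power_mult_distrib)
    qed
    finally show False by simp
  qed
qed

text \<open>In the balance identities \<open>x 0\<close>, the workload of order
  \<open>p - 1\<close>, \<open>F - \<beta> * N\<close> and the copies minus
  \<open>\<rho> * N\<close> are all within \<open>\<epsilon> * N\<close>. The coefficient
  \<open>2 * p + 5\<close> comes from the lower bound on \<open>x p\<close>: \<open>p + 1\<close>
  for \<open>F\<close>, 1 for the copies, \<open>p + 1\<close> for \<open>x 0\<close>, 2 for the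
  workload. The third claim is free of \<open>\<epsilon>\<close> and feeds the load
  estimate.\<close>

lemma lyapunov_less_1_balance:
  assumes N: "N \<ge> 1" and f: "lyapunov N x < 1" and x: "x \<in> network_states d F"
    and F: "\<bar>real F - \<beta> * real N\<bar> \<le> \<epsilon> * real N"
  shows "\<bar>real (x p) - ((real p + 1) * \<beta> - \<rho>) * real N\<bar> \<le> (2 * real p + 5) * \<epsilon> * real N"
    and "\<bar>real (x (p + 1)) - (\<rho> - real p * \<beta>) * real N\<bar> \<le> (2 * real p + 5) * \<epsilon> * real N"
    and "real (x (p + 1)) \<ge> real (copies d x) - real p * real F"
proof -
  note less = lyapunov_less_1[OF N f]
  let ?W = "real (workload d (p - 1) x)" and ?V = "real (workload d p x)"
    and ?L = "real (copies d x)" and ?P = "real p" and ?n = "real N"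
  have "x (p + 1) + p * F = copies d x + p * x 0 + workload d (p - 1) x"
    using x p less(1) by (intro balance_upper) auto
  then have "real (x (p + 1) + p * F) = real (copies d x + p * x 0 + workload d (p - 1) x)" by simp
  then have up: "real (x (p + 1)) + ?P * real F = ?L + ?P * real (x 0) + ?W" by simp
  have "workload d p x + copies d x + (p + 1) * x 0 = (p + 1) * F"
    using x p less(1) by (intro balance_lower) auto
  then have "real (workload d p x + copies d x + (p + 1) * x 0) = real ((p + 1) * F)" by simp
  then have low: "?V + ?L + (?P + 1) * real (x 0) = (?P + 1) * real F" by (simp add: algebra_simps)
  have V: "real (x p) \<le> ?V" "?V \<le> real (x p) + 2 * ?W"
    using workload_ge[of p d x] workload_le[of p d x] p by linarith+
  have x0: "?P * real (x 0) \<le> ?P * (\<epsilon> * ?n)" "?P * real (x 0) \<ge> 0"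
    using less(4) by (auto intro!: mult_left_mono)
  have PF: "?P * (real F - \<beta> * ?n) \<le> ?P * (\<epsilon> * ?n)" "?P * (\<beta> * ?n - real F) \<le> ?P * (\<epsilon> * ?n)"
    using F by (intro mult_left_mono; linarith)+
  have \<epsilon>n: "\<epsilon> * ?n \<ge> 0" using \<epsilon> by simp
  have W0: "?W \<ge> 0" by simp
  have pen: "?P * (\<epsilon> * ?n) \<ge> 0" using \<epsilon>n by simp
  show "real (x (p + 1)) \<ge> ?L - ?P * real F" using up x0 by linarith
  have expand: "(2 * ?P + 5) * \<epsilon> * ?n = 2 * (?P * (\<epsilon> * ?n)) + 5 * (\<epsilon> * ?n)"
    "?P * (real F - \<beta> * ?n) = ?P * real F - ?P * (\<beta> * ?n)"
    "?P * (\<beta> * ?n - real F) = ?P * (\<beta> * ?n) - ?P * real F"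
    "(\<rho> - ?P * \<beta>) * ?n = \<rho> * ?n - ?P * (\<beta> * ?n)"
    "((?P + 1) * \<beta> - \<rho>) * ?n = ?P * (\<beta> * ?n) + \<beta> * ?n - \<rho> * ?n"
    "(\<rho> + \<epsilon>) * ?n = \<rho> * ?n + \<epsilon> * ?n" "(\<rho> - \<epsilon>) * ?n = \<rho> * ?n - \<epsilon> * ?n"
    "(?P + 1) * real (x 0) = ?P * real (x 0) + real (x 0)" "(?P + 1) * real F = ?P * real F + real F"
    by (simp_all add: algebra_simps)
  have x00: "real (x 0) \<ge> 0" by simp
  show "\<bar>real (x (p + 1)) - (\<rho> - ?P * \<beta>) * ?n\<bar> \<le> (2 * ?P + 5) * \<epsilon> * ?n"
    using up x0 PF less(2-5) \<epsilon>n W0 pen unfolding abs_le_iff expand by linarith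
  show "\<bar>real (x p) - ((?P + 1) * \<beta> - \<rho>) * ?n\<bar> \<le> (2 * ?P + 5) * \<epsilon> * ?n"
    using low V x0 x00 PF less(2-5) \<epsilon>n W0 F pen unfolding abs_le_iff expand by linarith
qed

lemma lyapunov_drift:
  assumes N: "N \<ge> 1" and f: "lyapunov N x < 1" and x: "x \<in> network_states d F"
    and F: "\<bar>real F - \<beta> * real N\<bar> \<le> \<epsilon> * real N"
  shows "network_drift lam mu d N (lyapunov N) x \<le> drift_bound N"
proof -
  note less = lyapunov_less_1[OF N f]
  note balance = lyapunov_less_1_balance[OF N f x F]
  \<comment> \<open>The target value of \<open>x p\<close> exceeds the error, so level
    \<open>p\<close> is occupied and the state is busy.\<close>
  have "(2 * real p + 5) * \<epsilon> * real N < ((real p + 1) * \<beta> - \<rho>) * real N"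
    using \<epsilon>_lower N by (intro mult_strict_right_mono) auto
  then have "x p > 0" using balance(1) by (cases "x p") auto
  define k where "k = (LEAST k. 1 \<le> k \<and> x k > 0)"
  have k: "1 \<le> k" "x k > 0" "k \<le> p" "\<And>i. 1 \<le> i \<Longrightarrow> i < k \<Longrightarrow> x i = 0"
  proof -
    have *: "1 \<le> p \<and> x p > 0" using p \<open>x p > 0\<close> by simp
    show "1 \<le> k" "x k > 0" using LeastI[of "\<lambda>k. 1 \<le> k \<and> x k > 0", OF *] by (auto simp: k_def)
    show "k \<le> p" unfolding k_def using * by (rule Least_le)
    show "x i = 0" if "1 \<le> i" "i < k" for i
      using not_less_Least[of i "\<lambda>k. 1 \<le> k \<and> x k > 0"] that by (auto simp: k_def)
  qed
  interpret busy: busy_state lam mu d p N k x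
    using lam mu p k less(1) by unfold_locales auto
  let ?W = "\<lambda>l. real (workload d l x)" and ?n = "real N"
  \<comment> \<open>\<open>a l\<close> is the decrease of the \<open>l\<close>-th tower term and
    bounds the increase of the preceding one, so the drifts telescope; \<open>rn\<close> matches the
    coefficients.\<close>
  define a where "a = (\<lambda>l. C * (r / ?n) ^ (l - 1) * ?W l ^ l)"
  have rn: "lam * ?n * (r / ?n) ^ l = C * (r / ?n) ^ (l - 1)" if "l \<ge> 1" for l
  proof -
    have "(r / ?n) ^ l = r / ?n * (r / ?n) ^ (l - 1)" using that by (cases l) auto
    then show ?thesis using lam N by (simp add: r_def)
  qed
  have rn0: "(r / ?n) ^ l \<ge> 0" for l using pos by simp
  have step: "busy.drift (\<lambda>x. (r / ?n) ^ l * power_sum l (workload d l x)) x \<le> a (Suc l) - a l"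
    if l: "l \<in> {1..<p - 1}" for l
  proof -
    have Suc_l: "Suc l \<le> d" using l p by auto
    have "mu * real (\<Sum>j = 2..l + 1. j * x j) * (?W l + 1) ^ l \<le> C * ?W (Suc l) ^ Suc l"
    \<comment> \<open>If the next workload is 0 there are no losses to count; otherwise it is at
      least 1 and absorbs the \<open>+ 1\<close> by a factor 2.\<close>
    proof (cases "workload d (Suc l) x = 0")
      case True
      then have "(\<Sum>j = 2..l + 1. j * x j) = 0"
        using loss_sum_le_workload[OF Suc_l, of x] by (simp del: sum_eq_0_iff sum.cl_ivl_Suc)
      then show ?thesis using pos by (simp only: True) simp
    next
      case False
      then have "?W l + 1 \<le> 2 * ?W (Suc l)" using workload_mono[of l "Suc l" d x] by linarith
      then have "(?W l + 1) ^ l \<le> (2 * ?W (Suc l)) ^ l" by (intro power_mono) auto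
      also have "\<dots> \<le> 2 ^ p * ?W (Suc l) ^ l"
        unfolding power_mult_distrib using l by (intro mult_right_mono power_increasing) auto
      finally have 1: "(?W l + 1) ^ l \<le> 2 ^ p * ?W (Suc l) ^ l" .
      have "(\<Sum>j = 2..l + 1. j * x j) \<le> p * workload d (Suc l) x"
      proof -
        have "(\<Sum>j = 2..l + 1. j * x j) \<le> Suc l * workload d (Suc l) x"
          using loss_sum_le_workload[OF Suc_l, of x] by (simp only: Suc_eq_plus1)
        also have "\<dots> \<le> p * workload d (Suc l) x" using l by (intro mult_right_mono) auto
        finally show ?thesis .
      qed
      then have "real (\<Sum>j = 2..l + 1. j * x j) \<le> real p * ?W (Suc l)"
        by (metis of_nat_le_iff of_nat_mult)
      then have "mu * real (\<Sum>j = 2..l + 1. j * x j) * (?W l + 1) ^ l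
          \<le> mu * (real p * ?W (Suc l)) * (2 ^ p * ?W (Suc l) ^ l)"
        using 1 mu by (intro mult_mono mult_left_mono) auto
      then show ?thesis by (simp add: C_def mult_ac)
    qed
    then have "busy.drift (\<lambda>x. power_sum l (workload d l x)) x
        \<le> C * ?W (Suc l) ^ Suc l - lam * ?n * ?W l ^ l"
      using busy.drift_workload[of l l] l p by fastforce
    then have "(r / ?n) ^ l * busy.drift (\<lambda>x. power_sum l (workload d l x)) x
        \<le> (r / ?n) ^ l * (C * ?W (Suc l) ^ Suc l - lam * ?n * ?W l ^ l)"
      using rn0 by (rule mult_left_mono)
    also have "\<dots> = C * (r / ?n) ^ l * ?W (Suc l) ^ Suc l - lam * ?n * (r / ?n) ^ l * ?W l ^ l"
      by (simp add: algebra_simps)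
    also have "\<dots> = a (Suc l) - a l" using rn[of l] l by (simp add: a_def)
    finally show ?thesis unfolding network_drift_mult .
  qed
  have last: "busy.drift (\<lambda>x. B * (r / ?n) ^ (p - 1) * power_sum (p - 1) (workload d (p - 1) x)) x
      \<le> C * (r / ?n) ^ (p - 2) * A - a (p - 1)"
  proof -
    let ?m = "p - 1" let ?w = "?W ?m"
    have pm: "p - 1 + 1 = p" "p - 1 - 1 = p - 2" using p by auto
    \<comment> \<open>With \<open>x (p + 1)\<close> at least the copies minus \<open>p * F\<close>,
      the losses from levels 2 to \<open>p\<close> are about
      \<open>p * ((p + 1) * \<beta> - \<rho>) * N\<close> at most, which is below
      \<open>p * \<beta> * N\<close> because \<open>\<rho> > p * \<beta>\<close>.\<close>
    have "(\<Sum>j = 2..p. j * x j) + (p + 1) * x (p + 1) \<le> copies d x"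
      using p by (intro loss_sum_le_copies) auto
    then have "real ((\<Sum>j = 2..p. j * x j) + (p + 1) * x (p + 1)) \<le> real (copies d x)"
      by (simp only: of_nat_le_iff)
    then have "real (\<Sum>j = 2..p. j * x j) \<le> real (copies d x) - (real p + 1) * real (x (p + 1))"
      by (simp only: of_nat_add of_nat_mult of_nat_1)
    also have "\<dots> \<le> real (copies d x) - (real p + 1) * (real (copies d x) - real p * real F)"
      using balance(3) by (intro diff_left_mono mult_left_mono) auto
    also have "\<dots> = real p * ((real p + 1) * real F - real (copies d x))"
      by (simp add: algebra_simps)
    also have "\<dots> \<le> real p * ((real p + 1) * ((\<beta> + \<epsilon>) * ?n) - (\<rho> - \<epsilon>) * ?n)"
      using F less(3) by (intro mult_left_mono diff_mono) (auto simp: algebra_simps)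
    also have "\<dots> = real p * (((real p + 1) * \<beta> - \<rho> + (real p + 2) * \<epsilon>) * ?n)"
      by (simp add: algebra_simps)
    also have "\<dots> \<le> real p * (\<beta> * ?n)"
      using \<epsilon>_upper by (intro mult_left_mono mult_right_mono) (auto simp: algebra_simps)
    finally have "mu * real (\<Sum>j = 2..p. j * x j) \<le> mu * (real p * (\<beta> * ?n))"
      using mu by (intro mult_left_mono) auto
    also have "\<dots> = lam * ?n * (real p * \<beta> / \<rho>)" using \<rho> pos by simp
    finally have "mu * real (\<Sum>j = 2..?m + 1. j * x j) * (?w + 1) ^ ?m
        \<le> lam * ?n * (real p * \<beta> / \<rho>) * (?w + 1) ^ ?m"
      unfolding pm by (intro mult_right_mono) auto
    then have "busy.drift (\<lambda>x. power_sum ?m (workload d ?m x)) x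
        \<le> lam * ?n * (real p * \<beta> / \<rho>) * (?w + 1) ^ ?m - lam * ?n * ?w ^ ?m"
      using busy.drift_workload[of ?m ?m] p by fastforce
    then have "B * (r / ?n) ^ ?m * busy.drift (\<lambda>x. power_sum ?m (workload d ?m x)) x
        \<le> B * (r / ?n) ^ ?m * (lam * ?n * (real p * \<beta> / \<rho>) * (?w + 1) ^ ?m - lam * ?n * ?w ^ ?m)"
      using rn0 B by (intro mult_left_mono) auto
    also have "\<dots> = lam * ?n * (r / ?n) ^ ?m * (B * (real p * \<beta> / \<rho>) * (?w + 1) ^ ?m - B * ?w ^ ?m)"
      by (simp add: algebra_simps)
    also have "\<dots> = C * (r / ?n) ^ (p - 2) * (B * (real p * \<beta> / \<rho>) * (?w + 1) ^ ?m - B * ?w ^ ?m)"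
      using rn[of ?m] p unfolding pm by simp
    \<comment> \<open>The choice of \<open>A\<close> and \<open>B\<close> leaves
      \<open>- ?w ^ ?m\<close>, which cancels the gain \<open>a (p - 1)\<close> remaining from the
      telescoping sum.\<close>
    also have "\<dots> \<le> C * (r / ?n) ^ (p - 2) * (A - ?w ^ ?m)"
      using A(2)[of "workload d ?m x"] pos by (intro mult_left_mono) auto
    also have "\<dots> = C * (r / ?n) ^ (p - 2) * A - a ?m"
      unfolding a_def pm by (simp add: algebra_simps)
    finally show ?thesis unfolding network_drift_mult .
  qed
  have first: "busy.drift (\<lambda>x. real (x 0)) x \<le> a 1"
  proof -
    have "real (x 1) \<le> ?W 1" using workload_ge[of 1 d x] p by simp
    moreover have "mu \<le> C"
    proof -
      have "mu * 1 * 1 \<le> C" unfolding C_def using mu p by (intro mult_mono one_le_power) auto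
      then show ?thesis by simp
    qed
    ultimately have "mu * real (x 1) \<le> C * ?W 1" using mu pos by (intro mult_mono) auto
    then show ?thesis unfolding busy.drift_lost a_def by simp
  qed
  have tower: "busy.drift (tower N) x \<le> C * (r / ?n) ^ (p - 2) * A"
  proof -
    have "busy.drift (\<lambda>x. \<Sum>l = 1..<p - 1. (r / ?n) ^ l * power_sum l (workload d l x)) x
        \<le> (\<Sum>l = 1..<p - 1. a (Suc l) - a l)"
      unfolding network_drift_sum[OF finite_atLeastLessThan] by (intro sum_mono step)
    \<comment> \<open>For \<open>p = 2\<close> the sum is empty and both terms are
      \<open>a 1\<close>.\<close>
    also have "\<dots> = a (p - 1) - a 1" using p by (intro sum_Suc_diff') auto
    finally show ?thesis using first last
      unfolding tower_def[abs_def] network_drift_add by linarith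
  qed
  have upper: "busy.drift (\<lambda>x. exp (\<theta> * (real (copies d x) - (\<rho> + \<epsilon>) * ?n))) x
      \<le> mu * (\<rho> + \<epsilon>) * ?n * exp \<theta> * exp (- (\<theta> * \<epsilon> * ?n / 2))"
  proof -
    have "busy.drift (\<lambda>x. exp (\<theta> * (real (copies d x) - (\<rho> + \<epsilon>) * ?n))) x
        \<le> lam * ?n * exp \<theta> * exp (- (\<theta> * \<epsilon> * ?n / 2))"
      using \<rho> pos \<theta> by (intro busy.drift_exp_upper) auto
    also have "\<dots> \<le> mu * (\<rho> + \<epsilon>) * ?n * exp \<theta> * exp (- (\<theta> * \<epsilon> * ?n / 2))"
      using \<rho> mu \<epsilon> by (intro mult_right_mono) (auto simp: algebra_simps)
    finally show ?thesis .
  qed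
  have lower: "busy.drift (\<lambda>x. exp (\<theta> * ((\<rho> - \<epsilon>) * ?n - real (copies d x)))) x
      \<le> mu * (\<rho> + \<epsilon>) * ?n * exp \<theta> * exp (- (\<theta> * \<epsilon> * ?n / 2))"
    using \<rho> pos \<theta> less(2) \<epsilon> by (intro busy.drift_exp_lower) auto
  have "inverse (\<epsilon>' * ?n) * busy.drift (tower N) x \<le> inverse (\<epsilon>' * ?n) * (C * (r / ?n) ^ (p - 2) * A)"
    using tower pos by (intro mult_left_mono) auto
  then show ?thesis
    using upper lower busy.drift_excess
    unfolding lyapunov_def[abs_def] network_drift_add network_drift_mult drift_bound_def
    by linarith
qed

end

section \<open>Convergence to a constant process\<close>

lemma space_cadlag_space: "space cadlag_space = (cadlag_paths :: (real \<Rightarrow> 'a::topological_space) set)"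
  by (auto simp: cadlag_space_def space_restrict_space space_PiM cadlag_paths_def PiE_def)

lemma topspace_compact_uniform:
  "topspace compact_uniform_topology = (cadlag_paths :: (real \<Rightarrow> 'a::metric_space) set)"
proof -
  have "openin compact_uniform_topology (cadlag_paths :: (real \<Rightarrow> 'a) set)"
    unfolding openin_compact_uniform_topology
    by (auto intro!: exI[of _ "{0}"] exI[of _ 1])
  moreover have "topspace compact_uniform_topology \<subseteq> (cadlag_paths :: (real \<Rightarrow> 'a) set)"
    using openin_topspace openin_compact_uniform_topology by blast
  ultimately show ?thesis using openin_subset by blast
qed

lemma const_in_cadlag_paths: "(\<lambda>t\<in>{0..}. c) \<in> cadlag_paths"
proof -
  have "((\<lambda>t\<in>{0..}. c) \<longlongrightarrow> c) (at_right t)" if "t \<ge> 0" for t :: real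
    using that by (intro tendsto_eventually) (auto simp: eventually_at_filter)
  moreover have "((\<lambda>t\<in>{0..}. c) \<longlongrightarrow> c) (at_left t)" if "t > 0" for t :: real
    by (rule tendsto_eventually, rule eventually_mono[OF eventually_at_left_real[OF that]]) simp
  ultimately show ?thesis by (auto simp: cadlag_paths_def cadlag_def)
qed

text \<open>The limit is a point mass, so continuity of the functional at the constant path
  \<open>k\<close> decides: off a small event the path is near \<open>k\<close>, and boundedness
  handles the event.\<close>

lemma converges_in_distribution_constantI:
  fixes Y :: "nat \<Rightarrow> 'w \<Rightarrow> real \<Rightarrow> 'a::metric_space"
  assumes Y: "\<forall>\<^sub>F N in sequentially. prob_space (M N) \<and> Y N \<in> M N \<rightarrow>\<^sub>M cadlag_space"
    and close: "\<And>T e \<eta> :: real. T > 0 \<Longrightarrow> e > 0 \<Longrightarrow> \<eta> > 0 \<Longrightarrow>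
      \<forall>\<^sub>F N in sequentially. \<exists>E\<in>sets (M N). measure (M N) E \<le> \<eta>
        \<and> (\<forall>w\<in>space (M N) - E. \<forall>t. 0 \<le> t \<longrightarrow> t < T \<longrightarrow> dist (Y N w t) c < e)"
  shows "converges_in_distribution M Y (constant_process_law c)"
proof -
  define k where "k = (\<lambda>t\<in>{0::real..}. c)"
  have k: "k \<in> cadlag_paths" unfolding k_def by (rule const_in_cadlag_paths)
  have "(\<lambda>N. \<integral>w. \<Phi> (Y N w) \<partial>M N) \<longlonglongrightarrow> (\<integral>f. \<Phi> f \<partial>constant_process_law c)"
    if meas: "\<Phi> \<in> borel_measurable cadlag_space" and bdd: "bounded (\<Phi> ` cadlag_paths)"
      and cont: "continuous_map compact_uniform_topology euclideanreal \<Phi>"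
    for \<Phi> :: "(real \<Rightarrow> 'a) \<Rightarrow> real"
  proof -
    obtain b where b: "b > 0" "\<And>f. f \<in> cadlag_paths \<Longrightarrow> \<bar>\<Phi> f\<bar> \<le> b"
      using bdd unfolding bounded_pos by auto
    have "(\<integral>f. \<Phi> f \<partial>constant_process_law c) = \<Phi> k"
      unfolding constant_process_law_def k_def[symmetric]
      using k meas by (intro integral_return) (auto simp: space_cadlag_space)
    moreover have "(\<lambda>N. \<integral>w. \<Phi> (Y N w) \<partial>M N) \<longlonglongrightarrow> \<Phi> k"
    proof (rule tendstoI)
      fix \<delta> :: real assume \<delta>: "\<delta> > 0"
      let ?U = "{f \<in> topspace compact_uniform_topology. \<Phi> f \<in> ball (\<Phi> k) (\<delta> / 2)}"
      have "openin compact_uniform_topology ?U"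
        using cont by (intro openin_continuous_map_preimage) auto
      moreover have "k \<in> ?U" using k \<delta> by (simp add: topspace_compact_uniform)
      ultimately obtain K e where K: "compact K" "K \<subseteq> {0..}" and e: "e > 0"
        and sub: "{g \<in> cadlag_paths. \<forall>t\<in>K. dist (g t) (k t) < e} \<subseteq> ?U"
        unfolding openin_compact_uniform_topology by blast
      obtain T where T: "T > 0" "\<And>t. t \<in> K \<Longrightarrow> t < T"
      proof -
        obtain B where B: "B > 0" "\<And>t. t \<in> K \<Longrightarrow> norm t \<le> B"
          using compact_imp_bounded[OF K(1)] unfolding bounded_pos by auto
        show ?thesis
          by (rule that[of "B + 1"]) (use B in \<open>fastforce+\<close>)
      qed
      \<comment> \<open>The bad event contributes at most
        \<open>2 * b * \<eta> = \<delta> / 4\<close>, next to \<open>\<delta> / 2\<close> from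
        continuity.\<close>
      define \<eta> where "\<eta> = \<delta> / (8 * b)"
      have \<eta>: "\<eta> > 0" using \<delta> b by (simp add: \<eta>_def)
      from Y close[OF T(1) e \<eta>]
      show "\<forall>\<^sub>F N in sequentially. dist (\<integral>w. \<Phi> (Y N w) \<partial>M N) (\<Phi> k) < \<delta>"
      proof eventually_elim
        case (elim N)
        then interpret prob_space "M N" by simp
        have YN: "Y N \<in> M N \<rightarrow>\<^sub>M cadlag_space" using elim by simp
        from elim obtain E where E: "E \<in> events" "prob E \<le> \<eta>"
          and near: "\<And>w t. w \<in> space (M N) - E \<Longrightarrow> 0 \<le> t \<Longrightarrow> t < T \<Longrightarrow> dist (Y N w t) c < e"
          by blast
        have path: "Y N w \<in> cadlag_paths" if "w \<in> space (M N)" for w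
          using measurable_space[OF YN that] by (simp add: space_cadlag_space)
        have int: "integrable (M N) (\<lambda>w. \<Phi> (Y N w))"
          using measurable_compose[OF YN meas] b(2)[OF path]
          by (intro integrable_const_bound[of _ b]) auto
        have bound: "\<bar>\<Phi> (Y N w) - \<Phi> k\<bar> \<le> \<delta> / 2 + 2 * b * indicator E w"
          if w: "w \<in> space (M N)" for w
        proof (cases "w \<in> E")
          case True
          then show ?thesis using b(2)[OF path[OF w]] b(2)[OF k] \<delta> by simp
        next
          case False
          have "dist (Y N w t) (k t) < e" if "t \<in> K" for t
            using near[of w t] T(2)[OF that] K(2) that False w by (auto simp: k_def)
          then have "Y N w \<in> ?U" using path[OF w] sub by blast
          then show ?thesis using False by (simp add: dist_real_def abs_minus_commute)
        qed
        have "\<bar>(\<integral>w. \<Phi> (Y N w) \<partial>M N) - \<Phi> k\<bar> = \<bar>\<integral>w. \<Phi> (Y N w) - \<Phi> k \<partial>M N\<bar>"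
          using int by (simp add: prob_space)
        also have "\<dots> \<le> (\<integral>w. \<bar>\<Phi> (Y N w) - \<Phi> k\<bar> \<partial>M N)"
          by (rule integral_abs_bound)
        also have "\<dots> \<le> (\<integral>w. \<delta> / 2 + 2 * b * indicator E w \<partial>M N)"
        proof (intro integral_mono)
          show "integrable (M N) (\<lambda>w. \<delta> / 2 + 2 * b * indicator E w)"
            using E(1) by (intro Bochner_Integration.integrable_add integrable_const
              integrable_mult_right integrable_real_indicator) (auto simp: less_top[symmetric])
        qed (use int bound in auto)
        also have "\<dots> = \<delta> / 2 + 2 * b * prob E"
          using E(1) by (subst Bochner_Integration.integral_add)
            (auto simp: prob_space less_top[symmetric] intro!: integrable_mult_right integrable_real_indicator)
        also have "\<dots> \<le> \<delta> / 2 + 2 * b * \<eta>"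
          using E(2) b(1) by (intro add_left_mono mult_left_mono) auto
        also have "\<dots> < \<delta>" using \<delta> b(1) by (simp add: \<eta>_def field_simps)
        finally show ?case by (simp add: dist_real_def)
      qed
    qed
    ultimately show ?thesis by simp
  qed
  moreover have "prob_space (constant_process_law c)"
    unfolding constant_process_law_def using k
    by (intro prob_space_return) (simp add: space_cadlag_space k_def)
  moreover have "sets (constant_process_law c) = sets cadlag_space"
    by (simp add: constant_process_law_def)
  ultimately show ?thesis using Y unfolding converges_in_distribution_def by blast
qed

section \<open>Path regularity and measurability of the rescaled process\<close>

lemma open_coordinate: "open {x :: nat \<Rightarrow> nat. x i = n}"
proof -
  have "open ((\<lambda>x :: nat \<Rightarrow> nat. x i) -` {n})"
    by (intro open_vimage continuous_on_product_coordinates discrete_topology_class.open_discrete)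
  then show ?thesis by (simp add: vimage_def)
qed

text \<open>Coordinates take values in the discrete space \<open>nat\<close>.\<close>

lemma eventually_coordinate:
  fixes f :: "'t \<Rightarrow> nat \<Rightarrow> nat"
  assumes "(f \<longlongrightarrow> l) G"
  shows "\<forall>\<^sub>F t in G. f t i = l i"
  using topological_tendstoD[OF assms open_coordinate[of i "l i"]] by simp

lemma network_states_discrete:
  assumes "x \<in> network_states d F"
  shows "\<exists>U. open U \<and> U \<inter> network_states d F = {x}"
proof -
  let ?U = "\<Inter>i\<in>{..d}. {y :: nat \<Rightarrow> nat. y i = x i}"
  have "open ?U" by (intro open_INT finite_atMost ballI open_coordinate)
  moreover have "?U \<inter> network_states d F = {x}"
  proof -
    have "y = x" if "y \<in> network_states d F" "\<And>i. i \<le> d \<Longrightarrow> y i = x i" for y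
    proof
      fix i show "y i = x i" using that assms by (cases "i \<le> d") (auto simp: network_states_def)
    qed
    with assms show ?thesis by auto
  qed
  ultimately show ?thesis by blast
qed

text \<open>One-sided limits of integer coordinates are eventually attained, so they pass through
  any \<open>g\<close>; \<open>a > 0\<close> preserves the side of approach.\<close>

lemma cadlag_scaled_coordinates:
  fixes f :: "real \<Rightarrow> nat \<Rightarrow> nat" and g :: "nat \<Rightarrow> nat \<Rightarrow> 'a::topological_space"
  assumes f: "cadlag f" and a: "a > 0"
  shows "(\<lambda>t\<in>{0..}. g (f (a * t) i) (f (a * t) j)) \<in> cadlag_paths"
proof -
  let ?h = "\<lambda>t\<in>{0..}. g (f (a * t) i) (f (a * t) j)"
  have right: "(?h \<longlongrightarrow> ?h t) (at_right t)" if t: "t \<ge> 0" for t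
  proof -
    have "filterlim (\<lambda>t. a * t) (at_right (a * t)) (at_right t)"
      unfolding filterlim_at using a
      by (intro conjI tendsto_intros) (auto simp: eventually_at_filter)
    moreover have "(f \<longlongrightarrow> f (a * t)) (at_right (a * t))" using f t a by (auto simp: cadlag_def)
    ultimately have lim: "((\<lambda>t. f (a * t)) \<longlongrightarrow> f (a * t)) (at_right t)" by (rule filterlim_compose[rotated])
    have "\<forall>\<^sub>F u in at_right t. u > t" by (simp add: eventually_at_filter)
    with eventually_coordinate[OF lim, of i] eventually_coordinate[OF lim, of j]
    have "\<forall>\<^sub>F u in at_right t. ?h u = ?h t" by eventually_elim (use t in auto)
    then show ?thesis by (rule tendsto_eventually)
  qed
  have left: "\<exists>l. (?h \<longlongrightarrow> l) (at_left t)" if t: "t > 0" for t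
  proof -
    have "filterlim (\<lambda>t. a * t) (at_left (a * t)) (at_left t)"
      unfolding filterlim_at using a
      by (intro conjI tendsto_intros) (auto simp: eventually_at_filter)
    moreover have "a * t > 0" using t a by simp
    then obtain l where "(f \<longlongrightarrow> l) (at_left (a * t))" using f unfolding cadlag_def by blast
    ultimately have lim: "((\<lambda>t. f (a * t)) \<longlongrightarrow> l) (at_left t)" by (rule filterlim_compose[rotated])
    \<comment> \<open>\<open>eventually_at_left_real\<close> keeps the times positive, where the
      restriction is not \<open>undefined\<close>.\<close>
    from eventually_coordinate[OF lim, of i] eventually_coordinate[OF lim, of j]
      eventually_at_left_real[OF t]
    have "\<forall>\<^sub>F u in at_left t. ?h u = g (l i) (l j)" by eventually_elim auto
    then show ?thesis by (intro exI tendsto_eventually)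
  qed
  show ?thesis using right left by (auto simp: cadlag_paths_def cadlag_def)
qed

lemma measurable_scaled_coordinates:
  fixes g :: "nat \<Rightarrow> nat \<Rightarrow> 'a::topological_space"
  assumes "markov_jump_process M S r (X :: real \<Rightarrow> 'w \<Rightarrow> nat \<Rightarrow> nat)" and a: "a > 0"
  shows "(\<lambda>w. \<lambda>t\<in>{0..}. g (X (a * t) w i) (X (a * t) w j)) \<in> M \<rightarrow>\<^sub>M cadlag_space"
proof -
  interpret markov_jump M S r X by unfold_locales (rule assms)
  show ?thesis
    unfolding cadlag_space_def
  proof (intro measurable_restrict_space2 measurable_restrict)
    show "(\<lambda>w. \<lambda>t\<in>{0..}. g (X (a * t) w i) (X (a * t) w j)) \<in> space M \<rightarrow> cadlag_paths"
    proof
      fix w assume "w \<in> space M"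
      from cadlag_scaled_coordinates[OF cadlag_X[OF this] a, of g i j]
      show "(\<lambda>t\<in>{0..}. g (X (a * t) w i) (X (a * t) w j)) \<in> cadlag_paths" .
    qed
    show "(\<lambda>w. g (X (a * t) w i) (X (a * t) w j)) \<in> borel_measurable M" if "t \<in> {0..}" for t
      using measurable_compose[OF measurable_X[of "a * t"], of "\<lambda>x. g (x i) (x j)" borel] that a
      by simp
  qed
qed

lemma weighted_count_support:
  assumes "p < d" "1 \<le> p" "\<And>i. 1 \<le> i \<Longrightarrow> i \<le> d \<Longrightarrow> i \<notin> {p, p + 1} \<Longrightarrow> x i = 0"
  shows "weighted_count d v x = v 0 * x 0 + v p * x p + v (p + 1) * x (p + 1)"
proof -
  have "weighted_count d v x = (\<Sum>i\<in>{0, p, p + 1}. v i * x i)"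
    unfolding weighted_count_def using assms by (intro sum.mono_neutral_right) auto
  then show ?thesis using assms(2) by simp
qed

section \<open>Asymptotics of the Lyapunov function as \<open>N\<close> grows\<close>

context regime
begin

text \<open>The tower part is of order \<open>1 / N\<close>, the exponential part of order
  \<open>N ^ (p - 1) * exp (- c * N)\<close>.\<close>

lemma drift_bound_limit:
  "(\<lambda>N. drift_bound N * (real N ^ (p - 2) * T)) \<longlonglongrightarrow> 0"
proof -
  define c where "c = \<theta> * \<epsilon> / 2"
  have c: "c > 0" using \<theta> \<epsilon> by (simp add: c_def)
  define K where "K = 2 * mu * (\<rho> + \<epsilon>) * exp \<theta> * T / c ^ (p - 1)"
  have "filterlim (\<lambda>N. c * real N) at_top sequentially"
    using c by (intro filterlim_tendsto_pos_mult_at_top[OF tendsto_const] filterlim_real_sequentially)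
  from filterlim_compose[OF tendsto_power_div_exp_0 this]
  have "(\<lambda>N. (c * real N) ^ (p - 1) / exp (c * real N)) \<longlonglongrightarrow> 0" .
  then have lim: "(\<lambda>N. C * r ^ (p - 2) * A * T / \<epsilon>' * inverse (real N)
      + K * ((c * real N) ^ (p - 1) / exp (c * real N))) \<longlonglongrightarrow> C * r ^ (p - 2) * A * T / \<epsilon>' * 0 + K * 0"
    by (intro tendsto_intros lim_inverse_n)
  have eq: "\<forall>\<^sub>F N in sequentially. C * r ^ (p - 2) * A * T / \<epsilon>' * inverse (real N)
      + K * ((c * real N) ^ (p - 1) / exp (c * real N)) = drift_bound N * (real N ^ (p - 2) * T)"
    using eventually_gt_at_top[of 0]
  proof eventually_elim
    case (elim N)
    have 1: "inverse (\<epsilon>' * real N) * (C * (r / real N) ^ (p - 2) * A) * (real N ^ (p - 2) * T)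
        = C * r ^ (p - 2) * A * T / \<epsilon>' * inverse (real N)"
      using elim by (simp add: power_divide field_simps)
    have "Suc (p - 2) = p - 1" using p by simp
    then have pow: "real N ^ (p - 1) = real N * real N ^ (p - 2)" by (metis power_Suc)
    have exp_c: "exp (- (\<theta> * \<epsilon> * real N / 2)) = inverse (exp (c * real N))"
      by (simp add: c_def exp_minus)
    have "K * ((c * real N) ^ (p - 1) / exp (c * real N))
        = 2 * mu * (\<rho> + \<epsilon>) * exp \<theta> * T * real N ^ (p - 1) * inverse (exp (c * real N))"
      using c by (simp add: K_def power_mult_distrib divide_inverse)
    then have 2: "2 * (mu * (\<rho> + \<epsilon>) * real N * exp \<theta> * exp (- (\<theta> * \<epsilon> * real N / 2)))
        * (real N ^ (p - 2) * T) = K * ((c * real N) ^ (p - 1) / exp (c * real N))"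
      unfolding exp_c pow by (simp only: mult_ac)
    show ?case unfolding drift_bound_def distrib_right 1 2 ..
  qed
  show ?thesis using Lim_transform_eventually[OF lim eq] by simp
qed

text \<open>Levels \<open>p\<close> and \<open>p + 1\<close> have weight 0 in the workloads up to
  order \<open>p - 1\<close>. Their limits add up to \<open>\<beta>\<close>, so
  \<open>x0 N 0\<close> is \<open>o(N)\<close>, and carry \<open>\<rho>\<close> copies, so both
  exponents tend to minus infinity.\<close>

lemma lyapunov_initial_limit:
  fixes F :: "nat \<Rightarrow> nat"
  assumes F: "(\<lambda>N. real (F N) / real N) \<longlonglongrightarrow> \<beta>"
    and states: "\<And>N. N \<ge> 1 \<Longrightarrow> x0 N \<in> network_states d (F N)"
    and support: "\<And>N i. N \<ge> 1 \<Longrightarrow> 1 \<le> i \<Longrightarrow> i \<le> d \<Longrightarrow> i \<notin> {p, p + 1} \<Longrightarrow> x0 N i = 0"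
    and lim: "(\<lambda>N. real (x0 N p) / real N) \<longlonglongrightarrow> (real p + 1) * \<beta> - \<rho>"
      "(\<lambda>N. real (x0 N (p + 1)) / real N) \<longlonglongrightarrow> \<rho> - real p * \<beta>"
  shows "(\<lambda>N. lyapunov N (x0 N)) \<longlonglongrightarrow> 0"
proof -
  \<comment> \<open>Copies divided by \<open>N\<close>; \<open>z\<close> below is the number of lost
    files divided by \<open>N\<close>.\<close>
  define u where "u = (\<lambda>N. real p * (real (x0 N p) / real N) + (real p + 1) * (real (x0 N (p + 1)) / real N))"
  have "u \<longlonglongrightarrow> real p * ((real p + 1) * \<beta> - \<rho>) + (real p + 1) * (\<rho> - real p * \<beta>)"
    unfolding u_def by (intro tendsto_intros lim)
  then have u: "u \<longlonglongrightarrow> \<rho>" by (simp add: algebra_simps)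
  have exp_lim: "(\<lambda>N. exp (v N * real N)) \<longlonglongrightarrow> 0" if "v \<longlonglongrightarrow> c" "c < 0" for v and c :: real
    using filterlim_compose[OF exp_at_bot
      filterlim_tendsto_neg_mult_at_bot[OF that filterlim_real_sequentially]] .
  have "(\<lambda>N. \<theta> * (u N - (\<rho> + \<epsilon>))) \<longlonglongrightarrow> \<theta> * (\<rho> - (\<rho> + \<epsilon>))"
    "(\<lambda>N. \<theta> * ((\<rho> - \<epsilon>) - u N)) \<longlonglongrightarrow> \<theta> * ((\<rho> - \<epsilon>) - \<rho>)"
    by (intro tendsto_intros u)+
  then have e: "(\<lambda>N. exp (\<theta> * (u N - (\<rho> + \<epsilon>)) * real N)) \<longlonglongrightarrow> 0"
      "(\<lambda>N. exp (\<theta> * ((\<rho> - \<epsilon>) - u N) * real N)) \<longlonglongrightarrow> 0"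
    using \<theta>(1) \<epsilon> by (auto intro!: exp_lim simp: mult_less_0_iff)
  define z where "z = (\<lambda>N. real (F N) / real N - real (x0 N p) / real N - real (x0 N (p + 1)) / real N)"
  have "z \<longlonglongrightarrow> \<beta> - ((real p + 1) * \<beta> - \<rho>) - (\<rho> - real p * \<beta>)"
    unfolding z_def by (intro tendsto_intros F lim)
  then have z: "z \<longlonglongrightarrow> 0" by (simp add: algebra_simps)
  have sum: "(\<lambda>N. inverse \<epsilon>' * z N + exp (\<theta> * (u N - (\<rho> + \<epsilon>)) * real N)
      + exp (\<theta> * ((\<rho> - \<epsilon>) - u N) * real N)) \<longlonglongrightarrow> inverse \<epsilon>' * 0 + 0 + 0"
    by (intro tendsto_intros z e)
  have eq: "\<forall>\<^sub>F N in sequentially. inverse \<epsilon>' * z N + exp (\<theta> * (u N - (\<rho> + \<epsilon>)) * real N)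
      + exp (\<theta> * ((\<rho> - \<epsilon>) - u N) * real N) = lyapunov N (x0 N)"
    using eventually_ge_at_top[of 1]
  proof eventually_elim
    case (elim N)
    have p1: "1 \<le> p" using p by simp
    note count = weighted_count_support[of p d "x0 N", OF p(2) p1 support[OF elim]]
    have F_eq: "F N = x0 N 0 + x0 N p + x0 N (p + 1)"
      using states[OF elim] count[of "\<lambda>_. 1"] p1 by (simp add: network_states_iff)
    have "copies d (x0 N) = p * x0 N p + (p + 1) * x0 N (p + 1)"
      unfolding copies_def using count[of "\<lambda>i. i"] p1 by simp
    then have copies: "real (copies d (x0 N)) = u N * real N"
      using elim by (simp add: u_def field_simps)
    have excess: "excess d p (x0 N) = 0"
      unfolding excess_def using count[of "\<lambda>i. of_bool (p + 2 \<le> i)"] p1 by simp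
    have W: "workload d l (x0 N) = 0" if "l \<le> p - 1" for l
      unfolding workload_def using count[of "\<lambda>i. if i = 0 then 0 else l + 1 - i"] that p1 by simp
    have "(\<Sum>l = 1..<p - 1. (r / real N) ^ l * power_sum l (workload d l (x0 N))) = 0"
      by (intro sum.neutral) (auto simp: W power_sum_0)
    then have "tower N (x0 N) = real (x0 N 0)"
      using p by (simp add: tower_def W power_sum_0)
    also have "\<dots> = z N * real N" using elim by (simp add: z_def F_eq field_simps)
    finally have "inverse (\<epsilon>' * real N) * tower N (x0 N) = inverse \<epsilon>' * z N"
      using elim by simp
    then show ?case unfolding lyapunov_def copies excess by (auto simp: algebra_simps)
  qed
  show ?thesis using Lim_transform_eventually[OF sum eq] by simp
qed

text \<open>The maximal inequality with horizon \<open>N ^ (p - 2) * T\<close>: initial value and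
  accumulated drift both vanish in the limit.\<close>

lemma eventually_lyapunov_less_1:
  fixes F :: "nat \<Rightarrow> nat" and X :: "nat \<Rightarrow> real \<Rightarrow> 'w \<Rightarrow> nat \<Rightarrow> nat"
  assumes F: "(\<lambda>N. real (F N) / real N) \<longlonglongrightarrow> \<beta>"
    and process: "\<And>N. N \<ge> 1 \<Longrightarrow>
      markov_jump_process (M N) (network_states d (F N)) (network_rate lam mu d N) (X N)"
    and init: "\<And>N. N \<ge> 1 \<Longrightarrow> AE w in M N. X N 0 w = x0 N"
    and support: "\<And>N i. N \<ge> 1 \<Longrightarrow> 1 \<le> i \<Longrightarrow> i \<le> d \<Longrightarrow> i \<notin> {p, p + 1} \<Longrightarrow> x0 N i = 0"
    and lim: "(\<lambda>N. real (x0 N p) / real N) \<longlonglongrightarrow> (real p + 1) * \<beta> - \<rho>"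
      "(\<lambda>N. real (x0 N (p + 1)) / real N) \<longlonglongrightarrow> \<rho> - real p * \<beta>"
    and T: "T > 0" and \<eta>: "\<eta> > 0"
  shows "\<forall>\<^sub>F N in sequentially. N \<ge> 1 \<and> \<bar>real (F N) - \<beta> * real N\<bar> \<le> \<epsilon> * real N \<and>
    (\<exists>E\<in>sets (M N). measure (M N) E \<le> \<eta> \<and> (\<forall>w\<in>space (M N) - E. \<forall>t. 0 \<le> t \<longrightarrow>
      t < real N ^ (p - 2) * T \<longrightarrow> lyapunov N (X N t w) < 1))"
proof -
  have states: "x0 N \<in> network_states d (F N)" if "N \<ge> 1" for N
  proof -
    interpret markov_jump "M N" "network_states d (F N)" "network_rate lam mu d N" "X N"
      by unfold_locales (rule process[OF that])
    show ?thesis by (rule initial_state[OF init[OF that]])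
  qed
  have "(\<lambda>N. lyapunov N (x0 N) + drift_bound N * (real N ^ (p - 2) * T)) \<longlonglongrightarrow> 0 + 0"
    by (intro tendsto_add drift_bound_limit lyapunov_initial_limit[OF F states support lim])
  then have "\<forall>\<^sub>F N in sequentially. lyapunov N (x0 N) + drift_bound N * (real N ^ (p - 2) * T) < \<eta>"
    by (rule order_tendstoD) (use \<eta> in simp)
  moreover have "\<forall>\<^sub>F N in sequentially. dist (real (F N) / real N) \<beta> < \<epsilon>"
    using tendstoD[OF F \<epsilon>] .
  ultimately show ?thesis using eventually_ge_at_top[of 1]
  proof eventually_elim
    case (elim N)
    interpret markov_jump "M N" "network_states d (F N)" "network_rate lam mu d N" "X N"
      by unfold_locales (rule process[OF elim(3)])
    have "real (F N) - \<beta> * real N = (real (F N) / real N - \<beta>) * real N"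
      using elim(3) by (simp add: field_simps)
    then have "\<bar>real (F N) - \<beta> * real N\<bar> = \<bar>real (F N) / real N - \<beta>\<bar> * real N"
      by (simp add: abs_mult)
    also have "\<dots> \<le> \<epsilon> * real N"
      using elim(2) by (intro mult_right_mono) (auto simp: dist_real_def)
    finally have FN: "\<bar>real (F N) - \<beta> * real N\<bar> \<le> \<epsilon> * real N" .
    have "\<exists>E\<in>events. prob E \<le> lyapunov N (x0 N) + drift_bound N * (real N ^ (p - 2) * T)
      \<and> (\<forall>w\<in>space (M N) - E. \<forall>t. 0 \<le> t \<longrightarrow> t < real N ^ (p - 2) * T \<longrightarrow> lyapunov N (X N t w) < 1)"
    proof (rule maximal_inequality)
      show "(\<Sum>y\<in>network_states d (F N). network_rate lam mu d N x y * (lyapunov N y - lyapunov N x))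
          \<le> drift_bound N" if "x \<in> network_states d (F N)" "lyapunov N x < 1" for x
        unfolding network_rate_sum[OF finite_S that(1)]
        by (rule lyapunov_drift[OF elim(3) that(2,1) FN])
    qed (use init[OF elim(3)] T elim(3) lam mu in \<open>auto intro: network_rate_nonneg lyapunov_nonneg
        drift_bound_nonneg network_states_discrete\<close>)
    then obtain E where E: "E \<in> events" "prob E \<le> lyapunov N (x0 N) + drift_bound N * (real N ^ (p - 2) * T)"
      and less: "\<forall>w\<in>space (M N) - E. \<forall>t. 0 \<le> t \<longrightarrow> t < real N ^ (p - 2) * T \<longrightarrow> lyapunov N (X N t w) < 1"
      by (elim bexE conjE)
    have "prob E \<le> \<eta>" using E(2) elim(1) by linarith
    with E(1) less elim(3) FN show ?case by (intro conjI bexI)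
  qed
qed

end

section \<open>Convergence on the time scale \<open>N powr q\<close>\<close>

theorem proposition7:
  fixes lam mu \<beta> \<gamma> \<rho> q :: real
    and d p :: nat
    and F :: "nat \<Rightarrow> nat"
    and M :: "nat \<Rightarrow> 'w measure"
    and X :: "nat \<Rightarrow> real \<Rightarrow> 'w \<Rightarrow> nat \<Rightarrow> nat"
    and x0 :: "nat \<Rightarrow> nat \<Rightarrow> nat"
  assumes "lam > 0" and "mu > 0" and "d \<ge> 2"
    and "\<beta> > 0" and "\<gamma> \<ge> 0"
    and "(\<lambda>N. (real (F N) - real N * \<beta>) / sqrt (real N)) \<longlonglongrightarrow> \<gamma>"
    and "\<And>N. N \<ge> 1 \<Longrightarrow>
           markov_jump_process (M N) (network_states d (F N)) (network_rate lam mu d N) (X N)"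
    and "\<rho> = lam / mu"
    and "2 \<le> p" and "p < d"
    and "real p * \<beta> < \<rho>" and "\<rho> < (real p + 1) * \<beta>"
    and "\<And>N. N \<ge> 1 \<Longrightarrow> AE w in M N. X N 0 w = x0 N"
    and "\<And>N i. N \<ge> 1 \<Longrightarrow> 1 \<le> i \<Longrightarrow> i \<le> d \<Longrightarrow> i \<notin> {p, p + 1} \<Longrightarrow> x0 N i = 0"
    and "(\<lambda>N. (real (x0 N p) / real N, real (x0 N (p + 1)) / real N))
           \<longlonglongrightarrow> ((real p + 1) * \<beta> - \<rho>, \<rho> - real p * \<beta>)"
    and "q \<le> real p - 2"
  shows "converges_in_distribution M
           (\<lambda>N w. \<lambda>t\<in>{0..}. (real (X N (real N powr q * t) w p) / real N,
                             real (X N (real N powr q * t) w (p + 1)) / real N))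
           (constant_process_law ((real p + 1) * \<beta> - \<rho>, \<rho> - real p * \<beta>))"
proof (rule converges_in_distribution_constantI)
  note process = assms(7)
  show "\<forall>\<^sub>F N in sequentially. prob_space (M N) \<and>
      (\<lambda>w. \<lambda>t\<in>{0..}. (real (X N (real N powr q * t) w p) / real N,
        real (X N (real N powr q * t) w (p + 1)) / real N)) \<in> M N \<rightarrow>\<^sub>M cadlag_space"
    using eventually_ge_at_top[of 1]
  proof eventually_elim
    case (elim N)
    from process[OF elim] have "prob_space (M N)" by (simp add: markov_jump_process_def)
    moreover have "real N powr q > 0" using elim by simp
    ultimately show ?case
      using measurable_scaled_coordinates[OF process[OF elim],
        of "real N powr q" "\<lambda>m n. (real m / real N, real n / real N)" p "p + 1"] by simp
  qed
  have F: "(\<lambda>N. real (F N) / real N) \<longlonglongrightarrow> \<beta>"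
  proof -
    have "(\<lambda>N. inverse (sqrt (real N))) \<longlonglongrightarrow> 0"
      by (intro tendsto_inverse_0_at_top filterlim_compose[OF sqrt_at_top] filterlim_real_sequentially)
    then have lim: "(\<lambda>N. (real (F N) - real N * \<beta>) / sqrt (real N) * inverse (sqrt (real N)) + \<beta>)
        \<longlonglongrightarrow> \<gamma> * 0 + \<beta>"
      by (intro tendsto_intros assms(6))
    have eq: "\<forall>\<^sub>F N in sequentially. (real (F N) - real N * \<beta>) / sqrt (real N)
        * inverse (sqrt (real N)) + \<beta> = real (F N) / real N"
      using eventually_gt_at_top[of 0]
      by eventually_elim (simp add: field_simps)
    show ?thesis using Lim_transform_eventually[OF lim eq] by simp
  qed
  have lim: "(\<lambda>N. real (x0 N p) / real N) \<longlonglongrightarrow> (real p + 1) * \<beta> - \<rho>"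
      "(\<lambda>N. real (x0 N (p + 1)) / real N) \<longlonglongrightarrow> \<rho> - real p * \<beta>"
    using tendsto_fst[OF assms(15)] tendsto_snd[OF assms(15)] by simp_all
  fix T e \<eta> :: real assume T: "T > 0" and e: "e > 0" and \<eta>: "\<eta> > 0"
  define P where "P = 2 * real p + 5"
  \<comment> \<open>The first bound keeps two coordinate errors \<open>P * \<epsilon>\<close> below
    \<open>e\<close>, the second makes \<open>\<epsilon>_lower\<close> strict by half of the gap,
    the third gives \<open>\<epsilon>_upper\<close> since \<open>p + 2 \<le> P\<close>.\<close>
  define \<epsilon> where "\<epsilon> = min (e / (4 * P)) (min (((real p + 1) * \<beta> - \<rho>) / (2 * P)) ((\<rho> - real p * \<beta>) / P))"
  have P: "P > 0" by (simp add: P_def)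
  have \<epsilon>: "\<epsilon> > 0" using P e assms by (simp add: \<epsilon>_def)
  have "\<epsilon> \<le> e / (4 * P)" "\<epsilon> \<le> ((real p + 1) * \<beta> - \<rho>) / (2 * P)" "\<epsilon> \<le> (\<rho> - real p * \<beta>) / P"
    unfolding \<epsilon>_def by auto
  then have \<epsilon>_le: "4 * (P * \<epsilon>) \<le> e" "2 * (P * \<epsilon>) \<le> (real p + 1) * \<beta> - \<rho>" "P * \<epsilon> \<le> \<rho> - real p * \<beta>"
    using P by (simp_all add: field_simps)
  have \<rho>: "\<rho> > 0" using assms by simp
  \<comment> \<open>Chosen so that \<open>\<rho> * (exp \<theta> - 1)\<close> equals
    \<open>\<epsilon> / 2\<close>.\<close>
  define \<theta> where "\<theta> = ln (1 + \<epsilon> / (2 * \<rho>))"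
  have "\<epsilon> / (2 * \<rho>) > 0" using \<epsilon> \<rho> by simp
  then have \<theta>: "\<theta> > 0" "\<rho> * (exp \<theta> - 1) \<le> \<epsilon> / 2" using \<rho> by (simp_all add: \<theta>_def)
  obtain A B where "B > 0" "A \<ge> 0" and AB: "\<And>w::nat. real w ^ (p - 1) - B * real w ^ (p - 1)
      + B * (real p * \<beta> / \<rho>) * (real w + 1) ^ (p - 1) \<le> A"
    using queue_constants[of "real p * \<beta> / \<rho>" "p - 1"] assms(4,11) \<rho> by auto
  interpret regime lam mu \<beta> \<rho> \<epsilon> \<theta> A B d p
  proof
    have "P * \<epsilon> > 0" using P \<epsilon> by simp
    then show "(2 * real p + 5) * \<epsilon> < (real p + 1) * \<beta> - \<rho>" using \<epsilon>_le(2) by (simp add: P_def)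
    have "(real p + 2) * \<epsilon> \<le> P * \<epsilon>" using \<epsilon> by (intro mult_right_mono) (auto simp: P_def)
    then show "(real p + 2) * \<epsilon> \<le> \<rho> - real p * \<beta>" using \<epsilon>_le(3) by simp
  qed (use assms \<epsilon> \<theta> AB \<open>B > 0\<close> \<open>A \<ge> 0\<close> in auto)
  let ?Y = "\<lambda>N w. \<lambda>t\<in>{0..}. (real (X N (real N powr q * t) w p) / real N,
    real (X N (real N powr q * t) w (p + 1)) / real N)"
  let ?c = "((real p + 1) * \<beta> - \<rho>, \<rho> - real p * \<beta>)"
  have "\<forall>\<^sub>F N in sequentially. N \<ge> 1 \<and> \<bar>real (F N) - \<beta> * real N\<bar> \<le> \<epsilon> * real N \<and>
    (\<exists>E\<in>sets (M N). measure (M N) E \<le> \<eta> \<and> (\<forall>w\<in>space (M N) - E. \<forall>t. 0 \<le> t \<longrightarrow>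
      t < real N ^ (p - 2) * T \<longrightarrow> lyapunov N (X N t w) < 1))"
    by (rule eventually_lyapunov_less_1[OF F process assms(13,14) lim T \<eta>])
  then show "\<forall>\<^sub>F N in sequentially. \<exists>E\<in>sets (M N). measure (M N) E \<le> \<eta>
      \<and> (\<forall>w\<in>space (M N) - E. \<forall>t. 0 \<le> t \<longrightarrow> t < T \<longrightarrow> dist (?Y N w t) ?c < e)"
  proof eventually_elim
    case (elim N)
    then have N: "N \<ge> 1" and FN: "\<bar>real (F N) - \<beta> * real N\<bar> \<le> \<epsilon> * real N" by auto
    from elim obtain E where E: "E \<in> sets (M N)" "measure (M N) E \<le> \<eta>"
      and less: "\<And>w t. w \<in> space (M N) - E \<Longrightarrow> 0 \<le> t \<Longrightarrow> t < real N ^ (p - 2) * T \<Longrightarrow>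
        lyapunov N (X N t w) < 1"
      by blast
    interpret markov_jump "M N" "network_states d (F N)" "network_rate lam mu d N" "X N"
      by unfold_locales (rule process[OF N])
    have "dist (?Y N w t) ?c < e" if w: "w \<in> space (M N) - E" and t: "0 \<le> t" "t < T" for w t
    proof -
      let ?s = "real N powr q * t"
      \<comment> \<open>\<open>q\<close> is real and may be negative; for \<open>N \<ge> 1\<close>
        the rescaled time still lies within the horizon \<open>N ^ (p - 2) * T\<close>.\<close>
      have "real N powr q \<le> real N powr real (p - 2)"
        using N assms(9,16) by (intro powr_mono) (auto simp: of_nat_diff)
      also have "\<dots> = real N ^ (p - 2)" using N by (intro powr_realpow) auto
      finally have "?s \<le> real N ^ (p - 2) * t" using t by (intro mult_right_mono)
      also have "\<dots> < real N ^ (p - 2) * T" using t N by (intro mult_strict_left_mono) auto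
      finally have s: "?s < real N ^ (p - 2) * T" .
      have s0: "?s \<ge> 0" using t by simp
      have "X N ?s w \<in> network_states d (F N)" using w s0 by (intro X_in) auto
      note balance = lyapunov_less_1_balance[OF N less[OF w s0 s] this FN, folded P_def]
      have close: "dist (real y / real N) c \<le> P * \<epsilon>"
        if "\<bar>real y - c * real N\<bar> \<le> P * \<epsilon> * real N" for y :: nat and c
      proof -
        have "real y / real N - c = (real y - c * real N) / real N" using N by (simp add: field_simps)
        then have "\<bar>real y / real N - c\<bar> = \<bar>real y - c * real N\<bar> / real N" by simp
        also have "\<dots> \<le> P * \<epsilon>" using that N by (simp add: field_simps)
        finally show ?thesis by (simp add: dist_real_def)
      qed
      have "dist (?Y N w t) ?c \<le> dist (real (X N ?s w p) / real N) ((real p + 1) * \<beta> - \<rho>)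
          + dist (real (X N ?s w (p + 1)) / real N) (\<rho> - real p * \<beta>)"
        using t by (simp add: dist_Pair_Pair sqrt_sum_squares_le_sum)
      also have "\<dots> \<le> P * \<epsilon> + P * \<epsilon>" by (intro add_mono close balance)
      also have "\<dots> < e" using \<epsilon>_le(1) e by simp
      finally show ?thesis .
    qed
    with E show ?case by blast
  qed
qed

end
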